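(* Let $q=2^m$ with $m\ge1$, let $1\le k\le q$, and let $P$ be an unknown polynomial over $\mathbf{F}_{2^m}$ of degree less than $k$. There is an algorithm which, given $m$, $k$ and the values of $P$ on a known set of at least $k$ points of $\mathbf{F}_{2^m}$, recovers all the systematic symbols of the codeword $[P]$, i.e. the values of $P$ at the first $k$ points of $\mathbf{F}_{2^m}$, using $O(q\log_2 q)$ operations plus $O(k)$ operations per missing systematic symbol; that is, $O(q\log_2 q+tk)$ operations in total, where $t$ is the number of the first $k$ points that do not belong to the known set. The constants implied by the $O$-notation are absolute (independent of $m$, $k$, $t$, $P$ and the set of known points).
   Context: Elements of $\mathbf{F}_{2^m}$ are represented as binary vectors $(x_1,\dots,x_m)$ of length $m$, viewing the field as an $m$-dimensional vector space over $\mathbf{F}_2$. The points of $\mathbf{F}_{2^m}$ are ordered lexicographically by these vectors, and $[P]$ denotes the vector of values of $P$ at all $q$ points in this order. The codewords of the Reed-Solomon code of dimension $k$ over $\mathbf{F}_{2^m}$ are the vectors $[P]$ with $P$ a polynomial of degree less than $k$. In the systematic encoding, the message consists of the first $k$ coordinates of $[P]$, which are called the systematic symbols. Cost model: each operation in the field $\mathbf{F}_{2^m}$ costs $O(1)$ time. Likewise, operations on integers of $O(m)$ bits (arithmetic, comparison, indexed memory access, reading a bit) cost $O(1)$ time. *)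

theory Defs
  imports Complex_Main "HOL-Library.List_Lexorder" "HOL-Library.Monad_Syntax"
    "HOL-Algebra.Polynomials"
begin

section \<open>The field with \<open>2 ^ m\<close> elements and the Reed-Solomon codewords\<close>

type_synonym vec = "bool list"

text \<open>
  A field structure on the binary vectors of length \<open>m\<close> whose addition is that of the vector
  space over the two-element field. The multiplication is left open, so that every choice of a
  basis of the field is covered. All fields live in the one type \<^typ>\<open>vec ring\<close>, so a
  statement can quantify over \<open>m\<close> and the field after having chosen an algorithm.
\<close>

definition binary_field :: "nat \<Rightarrow> vec ring \<Rightarrow> bool" where
  "binary_field m F \<longleftrightarrow>
     field F \<and> carrier F = {v. length v = m} \<and>
     (\<forall>u\<in>carrier F. \<forall>v\<in>carrier F. u \<oplus>\<^bsub>F\<^esub> v = map2 (\<noteq>) u v)"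

text \<open>
  The order on \<^typ>\<open>vec\<close> is the lexicographic one of \<^theory>\<open>HOL-Library.List_Lexorder\<close>,
  with \<open>False < True\<close> (0 before 1) and the first coordinate compared first.
\<close>

definition points :: "nat \<Rightarrow> vec list" where
  "points m = sorted_list_of_set {v. length v = m}"

definition codeword :: "nat \<Rightarrow> vec ring \<Rightarrow> vec list \<Rightarrow> vec list" where
  "codeword m F P = map (ring.eval F P) (points m)"

definition systematic_symbols :: "nat \<Rightarrow> nat \<Rightarrow> vec ring \<Rightarrow> vec list \<Rightarrow> vec list" where
  "systematic_symbols m k F P = take k (codeword m F P)"

section \<open>The machine model\<close>

text \<open>
  Algorithms are programs of a small imperative language over machine integers and field elements.
  A program is a finite piece of syntax that mentions neither \<open>m\<close> nor the field. It has
  finitely many registers and arrays of both sorts; array entries are addressed by nonnegative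
  machine integers. The field is accessible only through the field operations and through
  \<open>Index\<close> and \<open>Point\<close>, which reread the \<open>m\<close> bits of a vector as an integer and conversely.
\<close>

datatype iop = IAdd | ISub | IMul | IDiv | IMod | IBit

datatype fop = FAdd | FSub | FMul | FDiv

datatype iexp =
    IConst int
  | IVar string
  | IRead string iexp
  | IOp iop iexp iexp
  | Index fexp
and fexp =
    FZero
  | FOne
  | FVar string
  | FRead string iexp
  | FOp fop fexp fexp
  | Point iexp

datatype bexp =
    ILess iexp iexp
  | IEq iexp iexp
  | FEq fexp fexp
  | BNot bexp
  | BAnd bexp bexp

datatype com =
    Skip
  | IAssign string iexp
  | IWrite string iexp iexp
  | FAssign string fexp
  | FWrite string iexp fexp
  | Seq com com
  | Cond bexp com com
  | While bexp com

record state =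
  ivar :: "string \<Rightarrow> int"
  iarr :: "string \<Rightarrow> nat \<Rightarrow> int"
  fvar :: "string \<Rightarrow> vec"
  farr :: "string \<Rightarrow> nat \<Rightarrow> vec"

text \<open>
  Evaluation yields \<^const>\<open>None\<close> for undefined operations and whenever an integer does not
  fit into \<open>w\<close> bits (apart from the sign). The semantics of programs below has no rule for this,
  so a program that executes such an operation has no terminating run.
\<close>

definition word :: "nat \<Rightarrow> int \<Rightarrow> int option" where
  "word w n = (if \<bar>n\<bar> < 2 ^ w then Some n else None)"

fun iop_sem :: "iop \<Rightarrow> int \<Rightarrow> int \<Rightarrow> int option" where
  "iop_sem IAdd a b = Some (a + b)"
| "iop_sem ISub a b = Some (a - b)"
| "iop_sem IMul a b = Some (a * b)"
| "iop_sem IDiv a b = (if b = 0 then None else Some (a div b))"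
| "iop_sem IMod a b = (if b = 0 then None else Some (a mod b))"
| "iop_sem IBit a b = (if a < 0 \<or> b < 0 then None else Some (of_bool (bit a (nat b))))"

fun fop_sem :: "vec ring \<Rightarrow> fop \<Rightarrow> vec \<Rightarrow> vec \<Rightarrow> vec option" where
  "fop_sem F FAdd x y = Some (x \<oplus>\<^bsub>F\<^esub> y)"
| "fop_sem F FSub x y = Some (x \<ominus>\<^bsub>F\<^esub> y)"
| "fop_sem F FMul x y = Some (x \<otimes>\<^bsub>F\<^esub> y)"
| "fop_sem F FDiv x y = (if y = \<zero>\<^bsub>F\<^esub> then None else Some (x \<otimes>\<^bsub>F\<^esub> inv\<^bsub>F\<^esub> y))"

text \<open>The first coordinate of a vector is its most significant bit, as in the lexicographic order.\<close>

definition int_of_vec :: "vec \<Rightarrow> int" where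
  "int_of_vec v = horner_sum of_bool 2 (rev v)"

definition vec_of_int :: "nat \<Rightarrow> int \<Rightarrow> vec option" where
  "vec_of_int m n = (if 0 \<le> n \<and> n < 2 ^ m then Some (map (bit n) (rev [0..<m])) else None)"

definition address :: "int \<Rightarrow> nat option" where
  "address n = (if 0 \<le> n then Some (nat n) else None)"

primrec ieval :: "nat \<Rightarrow> vec ring \<Rightarrow> nat \<Rightarrow> state \<Rightarrow> iexp \<Rightarrow> int option"
  and feval :: "nat \<Rightarrow> vec ring \<Rightarrow> nat \<Rightarrow> state \<Rightarrow> fexp \<Rightarrow> vec option" where
  "ieval m F w s (IConst n) = word w n"
| "ieval m F w s (IVar x) = Some (ivar s x)"
| "ieval m F w s (IRead a e) =
     do { n \<leftarrow> ieval m F w s e; i \<leftarrow> address n; Some (iarr s a i) }"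
| "ieval m F w s (IOp f d e) =
     do { x \<leftarrow> ieval m F w s d; y \<leftarrow> ieval m F w s e; z \<leftarrow> iop_sem f x y; word w z }"
| "ieval m F w s (Index e) = do { v \<leftarrow> feval m F w s e; word w (int_of_vec v) }"
| "feval m F w s FZero = Some \<zero>\<^bsub>F\<^esub>"
| "feval m F w s FOne = Some \<one>\<^bsub>F\<^esub>"
| "feval m F w s (FVar x) = Some (fvar s x)"
| "feval m F w s (FRead a e) =
     do { n \<leftarrow> ieval m F w s e; i \<leftarrow> address n; Some (farr s a i) }"
| "feval m F w s (FOp f d e) =
     do { x \<leftarrow> feval m F w s d; y \<leftarrow> feval m F w s e; fop_sem F f x y }"
| "feval m F w s (Point e) = do { n \<leftarrow> ieval m F w s e; vec_of_int m n }"

primrec beval :: "nat \<Rightarrow> vec ring \<Rightarrow> nat \<Rightarrow> state \<Rightarrow> bexp \<Rightarrow> bool option" where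
  "beval m F w s (ILess d e) =
     do { x \<leftarrow> ieval m F w s d; y \<leftarrow> ieval m F w s e; Some (x < y) }"
| "beval m F w s (IEq d e) =
     do { x \<leftarrow> ieval m F w s d; y \<leftarrow> ieval m F w s e; Some (x = y) }"
| "beval m F w s (FEq d e) =
     do { x \<leftarrow> feval m F w s d; y \<leftarrow> feval m F w s e; Some (x = y) }"
| "beval m F w s (BNot b) = do { p \<leftarrow> beval m F w s b; Some (\<not> p) }"
| "beval m F w s (BAnd b c) =
     do { p \<leftarrow> beval m F w s b; q \<leftarrow> beval m F w s c; Some (p \<and> q) }"

text \<open>Evaluating an expression costs one time unit per node.\<close>

primrec icost :: "iexp \<Rightarrow> nat" and fcost :: "fexp \<Rightarrow> nat" where
  "icost (IConst n) = 1"
| "icost (IVar x) = 1"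
| "icost (IRead a e) = 1 + icost e"
| "icost (IOp f d e) = 1 + icost d + icost e"
| "icost (Index e) = 1 + fcost e"
| "fcost FZero = 1"
| "fcost FOne = 1"
| "fcost (FVar x) = 1"
| "fcost (FRead a e) = 1 + icost e"
| "fcost (FOp f d e) = 1 + fcost d + fcost e"
| "fcost (Point e) = 1 + icost e"

primrec bcost :: "bexp \<Rightarrow> nat" where
  "bcost (ILess d e) = 1 + icost d + icost e"
| "bcost (IEq d e) = 1 + icost d + icost e"
| "bcost (FEq d e) = 1 + fcost d + fcost e"
| "bcost (BNot b) = 1 + bcost b"
| "bcost (BAnd b c) = 1 + bcost b + bcost c"

text \<open>
  \<open>exec m F w p s T s'\<close>: over the field \<open>F\<close> and with integers of \<open>w\<close> bits, the program \<open>p\<close>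
  started in \<open>s\<close> terminates in \<open>s'\<close> after exactly \<open>T\<close> time units. The relation is deterministic.
\<close>

inductive exec :: "nat \<Rightarrow> vec ring \<Rightarrow> nat \<Rightarrow> com \<Rightarrow> state \<Rightarrow> nat \<Rightarrow> state \<Rightarrow> bool"
  for m :: nat and F :: "vec ring" and w :: nat where
  Skip: "exec m F w Skip s 1 s"
| IAssign: "ieval m F w s e = Some n \<Longrightarrow>
    exec m F w (IAssign x e) s (1 + icost e) (s\<lparr>ivar := (ivar s)(x := n)\<rparr>)"
| IWrite: "ieval m F w s d = Some l \<Longrightarrow> address l = Some i \<Longrightarrow> ieval m F w s e = Some n \<Longrightarrow>
    exec m F w (IWrite a d e) s (1 + icost d + icost e)
      (s\<lparr>iarr := (iarr s)(a := (iarr s a)(i := n))\<rparr>)"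
| FAssign: "feval m F w s e = Some v \<Longrightarrow>
    exec m F w (FAssign x e) s (1 + fcost e) (s\<lparr>fvar := (fvar s)(x := v)\<rparr>)"
| FWrite: "ieval m F w s d = Some l \<Longrightarrow> address l = Some i \<Longrightarrow> feval m F w s e = Some v \<Longrightarrow>
    exec m F w (FWrite a d e) s (1 + icost d + fcost e)
      (s\<lparr>farr := (farr s)(a := (farr s a)(i := v))\<rparr>)"
| Seq: "exec m F w p s T1 s1 \<Longrightarrow> exec m F w r s1 T2 s2 \<Longrightarrow>
    exec m F w (Seq p r) s (T1 + T2) s2"
| CondTrue: "beval m F w s b = Some True \<Longrightarrow> exec m F w p s T s1 \<Longrightarrow>
    exec m F w (Cond b p r) s (1 + bcost b + T) s1"
| CondFalse: "beval m F w s b = Some False \<Longrightarrow> exec m F w r s T s1 \<Longrightarrow>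
    exec m F w (Cond b p r) s (1 + bcost b + T) s1"
| WhileFalse: "beval m F w s b = Some False \<Longrightarrow>
    exec m F w (While b p) s (1 + bcost b) s"
| WhileTrue: "beval m F w s b = Some True \<Longrightarrow> exec m F w p s T1 s1 \<Longrightarrow>
    exec m F w (While b p) s1 T2 s2 \<Longrightarrow>
    exec m F w (While b p) s (1 + bcost b + T1 + T2) s2"

section \<open>Input and output\<close>

text \<open>
  The input consists of \<open>m\<close>, \<open>k\<close>, the list \<open>xs\<close> of known points and the list \<open>ys\<close> of the
  values there; all other storage is initially zero.
\<close>

definition input_state :: "nat \<Rightarrow> nat \<Rightarrow> vec ring \<Rightarrow> vec list \<Rightarrow> vec list \<Rightarrow> state" where
  "input_state m k F xs ys =
     \<lparr> ivar = (\<lambda>_. 0)(''m'' := int m, ''k'' := int k, ''n'' := int (length xs)),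
       iarr = (\<lambda>_ _. 0),
       fvar = (\<lambda>_. \<zero>\<^bsub>F\<^esub>),
       farr = (\<lambda>_ _. \<zero>\<^bsub>F\<^esub>)
         (''points'' := (\<lambda>i. if i < length xs then xs ! i else \<zero>\<^bsub>F\<^esub>),
          ''values'' := (\<lambda>i. if i < length ys then ys ! i else \<zero>\<^bsub>F\<^esub>)) \<rparr>"

definition read_symbols :: "nat \<Rightarrow> state \<Rightarrow> vec list" where
  "read_symbols k s = map (farr s ''symbols'') [0..<k]"

end

theory Submission
  imports Defs
begin

text \<open>
  Let \<open>S\<close> be the first \<open>k\<close> points, \<open>M\<close> the \<open>t\<close> missing ones among them, and \<open>E\<close> the first \<open>k\<close> known
  points, so that \<open>E\<close> arises from \<open>S\<close> by exchanging \<open>M\<close> for a set \<open>R\<close> of \<open>t\<close> extra points. Lagrange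
  interpolation on \<open>E\<close> costs \<open>O(k)\<close> per missing symbol once the products
  \<open>w x = (\<Prod>y\<in>E - {x}. x - y)\<close> are known. Up to factors \<open>0\<close>, which are replaced by \<open>1\<close>, \<open>w x\<close> is the
  product over \<open>S\<close> times that over \<open>R\<close> divided by that over \<open>M\<close>; the last two cost \<open>O(t)\<close> for
  each of the \<open>k\<close> points. For the first, the binary digits of \<open>k\<close> cut \<open>S\<close> into at most \<open>m + 1\<close>
  translates of the subspaces \<open>V b\<close> spanned by the first \<open>2 ^ b\<close> points, and a table of the products
  over \<open>V b\<close> at all points is filled in \<open>O(q m)\<close> steps, since \<open>V (b + 1)\<close> is the disjoint union
  of \<open>V b\<close> and one translate of it. The interpolation formula itself holds because divided
  differences on more than \<open>j + 1\<close> points annihilate the power \<open>x ^ j\<close>.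
\<close>

section \<open>Divided differences\<close>

context field
begin

section \<open>Inverses and nonzero products in a field\<close>

lemma inv_closed_nz [simp]: "x \<in> carrier R \<Longrightarrow> x \<noteq> \<zero> \<Longrightarrow> inv x \<in> carrier R"
  using field_Units Units_inv_closed by auto

lemma mult_inv_cancel [simp]: "x \<in> carrier R \<Longrightarrow> x \<noteq> \<zero> \<Longrightarrow> x \<otimes> inv x = \<one>"
  using field_Units Units_r_inv by auto

lemma inv_nz [simp]: "x \<in> carrier R \<Longrightarrow> x \<noteq> \<zero> \<Longrightarrow> inv x \<noteq> \<zero>"
  by (metis inv_closed_nz mult_inv_cancel r_null zero_not_one)

lemma mult_nz [simp]: "x \<in> carrier R \<Longrightarrow> y \<in> carrier R \<Longrightarrow> x \<noteq> \<zero> \<Longrightarrow> y \<noteq> \<zero> \<Longrightarrow> x \<otimes> y \<noteq> \<zero>"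
  using integral by blast

lemma mult_inv_eqI:
  assumes "a \<in> carrier R" "b \<in> carrier R" "c \<in> carrier R" "b \<noteq> \<zero>" "a = c \<otimes> b"
  shows "a \<otimes> inv b = c"
  using assms by (simp add: m_assoc)

lemma inv_mult_nz:
  assumes "x \<in> carrier R" "y \<in> carrier R" "x \<noteq> \<zero>" "y \<noteq> \<zero>"
  shows "inv (x \<otimes> y) = inv x \<otimes> inv y"
proof -
  have "\<one> \<otimes> inv (x \<otimes> y) = inv x \<otimes> inv y"
  proof (rule mult_inv_eqI)
    have "inv x \<otimes> inv y \<otimes> (x \<otimes> y) = (x \<otimes> inv x) \<otimes> (y \<otimes> inv y)"
      using assms by (simp add: m_ac del: mult_inv_cancel)
    then show "\<one> = inv x \<otimes> inv y \<otimes> (x \<otimes> y)" using assms by simp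
  qed (use assms in auto)
  then show ?thesis using assms by simp
qed

text \<open>Replacing a zero factor by one lets a single product formula serve the points outside a
  set and the points in it, where the factor at the point itself has to be left out.\<close>

definition nz :: "'a \<Rightarrow> 'a" where "nz x = (if x = \<zero> then \<one> else x)"

lemma nz_closed [simp]: "x \<in> carrier R \<Longrightarrow> nz x \<in> carrier R"
  by (simp add: nz_def)

lemma nz_nonzero [simp]: "nz x \<noteq> \<zero>"
  by (simp add: nz_def)

text \<open>For finite \<open>A\<close> and \<open>x\<close> outside \<open>A\<close> this is the
  value at \<open>x\<close> of the monic polynomial with simple roots \<open>A\<close>; for
  \<open>x\<close> in \<open>A\<close> it is the value of its derivative there, the denominator in
  Lagrange interpolation.\<close>

definition dprod :: "'a \<Rightarrow> 'a set \<Rightarrow> 'a" where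
  "dprod x A = (\<Otimes>y\<in>A. nz (x \<ominus> y))"

lemma dprod_empty [simp]: "dprod x {} = \<one>"
  by (simp add: dprod_def)

lemma dprod_closed [simp]: "x \<in> carrier R \<Longrightarrow> A \<subseteq> carrier R \<Longrightarrow> dprod x A \<in> carrier R"
  unfolding dprod_def by (rule finprod_closed) auto

lemma dprod_insert:
  assumes "finite A" "a \<notin> A" "A \<subseteq> carrier R" "a \<in> carrier R" "x \<in> carrier R"
  shows "dprod x (insert a A) = nz (x \<ominus> a) \<otimes> dprod x A"
  unfolding dprod_def using assms by (intro finprod_insert) auto

lemma dprod_Un:
  assumes "finite A" "finite B" "A \<inter> B = {}" "A \<subseteq> carrier R" "B \<subseteq> carrier R" "x \<in> carrier R"
  shows "dprod x (A \<union> B) = dprod x A \<otimes> dprod x B"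
  unfolding dprod_def using assms by (intro finprod_Un_disjoint) auto

lemma dprod_nonzero [simp]:
  assumes "A \<subseteq> carrier R" "x \<in> carrier R"
  shows "dprod x A \<noteq> \<zero>"
proof (cases "finite A")
  case True
  then show ?thesis using assms
    by (induction A) (auto simp: dprod_insert)
\<comment> \<open>A product over an infinite set is one by convention.\<close>
qed (simp add: dprod_def)

lemma dprod_insert_self:
  assumes "finite A" "x \<notin> A" "A \<subseteq> carrier R" "x \<in> carrier R"
  shows "dprod x (insert x A) = dprod x A"
  using assms by (simp add: dprod_insert a_minus_def r_neg nz_def)

text \<open>The divided difference of \<open>f\<close> on the nodes \<open>A\<close> in Lagrange
  form: for finite nonempty \<open>A\<close>, the coefficient of degree \<open>card A - 1\<close> of
  the interpolating polynomial. This form needs no order on the nodes.\<close>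

definition ddiff :: "'a set \<Rightarrow> ('a \<Rightarrow> 'a) \<Rightarrow> 'a" where
  "ddiff A f = (\<Oplus>x\<in>A. f x \<otimes> inv (dprod x A))"

lemma ddiff_closed [simp]:
  assumes "A \<subseteq> carrier R" "f \<in> A \<rightarrow> carrier R"
  shows "ddiff A f \<in> carrier R"
  unfolding ddiff_def using assms by (intro finsum_closed) (auto simp: subset_iff)

lemma ddiff_cong:
  assumes "A \<subseteq> carrier R" "g \<in> A \<rightarrow> carrier R" "\<And>x. x \<in> A \<Longrightarrow> f x = g x"
  shows "ddiff A f = ddiff A g"
  unfolding ddiff_def using assms
  by (intro finsum_cong') (auto simp: subset_iff Pi_iff)

lemma ddiff_add:
  assumes "A \<subseteq> carrier R" "f \<in> A \<rightarrow> carrier R" "g \<in> A \<rightarrow> carrier R"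
  shows "ddiff A (\<lambda>x. f x \<oplus> g x) = ddiff A f \<oplus> ddiff A g"
proof -
  have "ddiff A (\<lambda>x. f x \<oplus> g x) =
      (\<Oplus>x\<in>A. f x \<otimes> inv (dprod x A) \<oplus> g x \<otimes> inv (dprod x A))"
    unfolding ddiff_def using assms
    by (intro finsum_cong') (auto simp: subset_iff Pi_iff l_distr)
  also have "\<dots> = ddiff A f \<oplus> ddiff A g"
    unfolding ddiff_def using assms by (intro finsum_addf) (auto simp: subset_iff Pi_iff)
  finally show ?thesis .
qed

lemma ddiff_scale:
  assumes "finite A" "A \<subseteq> carrier R" "f \<in> A \<rightarrow> carrier R" "c \<in> carrier R"
  shows "ddiff A (\<lambda>x. c \<otimes> f x) = c \<otimes> ddiff A f"
proof -
  have "c \<otimes> ddiff A f = (\<Oplus>x\<in>A. c \<otimes> (f x \<otimes> inv (dprod x A)))"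
    unfolding ddiff_def using assms by (intro finsum_rdistr) (auto simp: subset_iff Pi_iff)
  also have "\<dots> = ddiff A (\<lambda>x. c \<otimes> f x)"
    unfolding ddiff_def using assms
    by (intro finsum_cong') (auto simp: subset_iff Pi_iff m_assoc)
  finally show ?thesis by simp
qed

text \<open>At \<open>a\<close> the linear factor kills the term; at any other node it cancels
  against the factor \<open>x - a\<close> of the denominator, which leaves the denominator for
  \<open>A - {a}\<close>.\<close>

lemma ddiff_linear_factor:
  assumes "finite A" "A \<subseteq> carrier R" "f \<in> A \<rightarrow> carrier R" "a \<in> A"
  shows "ddiff A (\<lambda>x. (x \<ominus> a) \<otimes> f x) = ddiff (A - {a}) f"
proof -
  define Y where "Y = A - {a}"
  have A: "A = insert a Y" and a: "a \<notin> Y" "a \<in> carrier R" and Y: "finite Y" "Y \<subseteq> carrier R"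
    and f: "f \<in> Y \<rightarrow> carrier R" "f a \<in> carrier R"
    using assms by (auto simp: Y_def)
  let ?t = "\<lambda>x. (x \<ominus> a) \<otimes> f x \<otimes> inv (dprod x A)"
  have t: "?t x = f x \<otimes> inv (dprod x Y)" if "x \<in> Y" for x
  proof -
    have x: "x \<in> carrier R" "x \<ominus> a \<noteq> \<zero>" "f x \<in> carrier R" using that Y a f by auto
    let ?u = "x \<ominus> a" and ?v = "inv (dprod x Y)"
    have u: "?u \<in> carrier R" and v: "?v \<in> carrier R" using x a Y by auto
    have "inv (dprod x A) = inv ?u \<otimes> ?v"
      using x a Y by (simp add: A dprod_insert nz_def inv_mult_nz)
    then have "?t x = (?u \<otimes> inv ?u) \<otimes> (f x \<otimes> ?v)"
      using u v x by (simp add: m_ac del: mult_inv_cancel)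
    then show ?thesis using u v x by simp
  qed
  have "ddiff A (\<lambda>x. (x \<ominus> a) \<otimes> f x) = ?t a \<oplus> (\<Oplus>x\<in>Y. ?t x)"
    unfolding ddiff_def A using Y a f assms(2)
    by (intro finsum_insert) (auto simp: subset_iff Pi_iff)
  also have "?t a = \<zero>"
    using a f assms(2) by (simp add: a_minus_def r_neg)
  also have "(\<Oplus>x\<in>Y. ?t x) = ddiff Y f"
    unfolding ddiff_def using Y f
    by (intro finsum_cong' t) (auto simp: subset_iff Pi_iff)
  finally show ?thesis using Y f by (simp add: Y_def)
qed

text \<open>For two nodes \<open>a\<close> and \<open>b\<close>, the functions \<open>x - a\<close>
  and \<open>x - b\<close> differ by the nonzero constant \<open>b - a\<close>, while
  \<open>ddiff_linear_factor\<close> turns their divided differences into those of the constant one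
  on two sets with one node fewer, which agree by induction.\<close>

lemma ddiff_const:
  assumes "finite A" "A \<subseteq> carrier R" "card A = Suc n"
  shows "ddiff A (\<lambda>_. \<one>) = (if n = 0 then \<one> else \<zero>)"
  using assms
proof (induction n arbitrary: A)
  case 0
  then obtain x where x: "A = {x}" "x \<in> carrier R" by (auto simp: card_Suc_eq)
  then show ?case
    using dprod_insert_self[of "{}" x] by (simp add: ddiff_def finsum_insert[of "{}"])
next
  case (Suc n)
  obtain a b where ab: "a \<in> A" "b \<in> A" "a \<noteq> b"
    using Suc.prems(3) by (auto simp: card_Suc_eq)
  have c: "a \<in> carrier R" "b \<in> carrier R" using ab Suc.prems by auto
  have minus: "ddiff A (\<lambda>x. x \<ominus> y) = ddiff (A - {y}) (\<lambda>_. \<one>)" if "y \<in> A" for y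
  proof -
    have "ddiff A (\<lambda>x. x \<ominus> y) = ddiff A (\<lambda>x. (x \<ominus> y) \<otimes> \<one>)"
      using that Suc.prems by (intro ddiff_cong) (auto simp: subset_iff)
    then show ?thesis using ddiff_linear_factor[of A "\<lambda>_. \<one>" y] that Suc.prems by simp
  qed
  have "ddiff A (\<lambda>x. x \<ominus> a) = ddiff A (\<lambda>x. (x \<ominus> b) \<oplus> (b \<ominus> a) \<otimes> \<one>)"
    using c Suc.prems
    by (intro ddiff_cong) (auto simp: subset_iff a_minus_def a_assoc r_neg1)
  also have "\<dots> = ddiff A (\<lambda>x. x \<ominus> b) \<oplus> ddiff A (\<lambda>x. (b \<ominus> a) \<otimes> \<one>)"
    using c Suc.prems by (intro ddiff_add) auto
  also have "ddiff A (\<lambda>x. (b \<ominus> a) \<otimes> \<one>) = (b \<ominus> a) \<otimes> ddiff A (\<lambda>_. \<one>)"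
    using c Suc.prems by (intro ddiff_scale) auto
  finally have "ddiff (A - {a}) (\<lambda>_. \<one>) =
      ddiff (A - {b}) (\<lambda>_. \<one>) \<oplus> (b \<ominus> a) \<otimes> ddiff A (\<lambda>_. \<one>)"
    using ab by (simp add: minus)
  \<comment> \<open>The induction hypothesis depends on the cardinality only, so the two values
    agree even where they are one.\<close>
  moreover have "ddiff (A - {a}) (\<lambda>_. \<one>) = ddiff (A - {b}) (\<lambda>_. \<one>)"
    using Suc.IH[of "A - {a}"] Suc.IH[of "A - {b}"] Suc.prems ab by (simp add: subset_iff)
  ultimately have "(b \<ominus> a) \<otimes> ddiff A (\<lambda>_. \<one>) = \<zero>"
    using c Suc.prems by (simp add: subset_iff)
  moreover have "b \<ominus> a \<noteq> \<zero>" using c ab by auto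
  ultimately show ?case
    using c Suc.prems integral[of "b \<ominus> a" "ddiff A (\<lambda>_. \<one>)"] by auto
qed

text \<open>Writing \<open>x ^ (j + 1)\<close> as \<open>(x - a) x ^ j + a x ^ j\<close> for a node
  \<open>a\<close> lowers the degree in both terms. The first term also loses the node
  \<open>a\<close>, which the bound on \<open>card A\<close> allows.\<close>

lemma ddiff_power:
  assumes "finite A" "A \<subseteq> carrier R" "j + 1 < card A"
  shows "ddiff A (\<lambda>x. x [^] (j::nat)) = \<zero>"
  using assms
proof (induction j arbitrary: A)
  case 0
  then obtain n where n: "card A = Suc n" "n \<noteq> 0" by (cases "card A") auto
  then show ?case using ddiff_const[of A n] 0 by simp
next
  case (Suc j)
  then obtain a where a: "a \<in> A" by fastforce
  then have c: "a \<in> carrier R" using Suc by auto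
  have "ddiff A (\<lambda>x. x [^] Suc j) = ddiff A (\<lambda>x. (x \<ominus> a) \<otimes> x [^] j \<oplus> a \<otimes> x [^] j)"
  proof (rule ddiff_cong)
    fix x assume "x \<in> A"
    then have x: "x \<in> carrier R" using Suc by auto
    have "(x \<ominus> a) \<otimes> x [^] j \<oplus> a \<otimes> x [^] j = (x \<ominus> a \<oplus> a) \<otimes> x [^] j"
      using x c by (simp add: l_distr)
    also have "\<dots> = x [^] Suc j" using x c by (simp add: a_minus_def a_assoc l_neg m_comm)
    finally show "x [^] Suc j = (x \<ominus> a) \<otimes> x [^] j \<oplus> a \<otimes> x [^] j" by simp
  qed (use Suc c in auto)
  also have "\<dots> = ddiff A (\<lambda>x. (x \<ominus> a) \<otimes> x [^] j) \<oplus> ddiff A (\<lambda>x. a \<otimes> x [^] j)"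
    using Suc c by (intro ddiff_add) auto
  also have "ddiff A (\<lambda>x. (x \<ominus> a) \<otimes> x [^] j) = ddiff (A - {a}) (\<lambda>x. x [^] j)"
    using Suc a by (intro ddiff_linear_factor) auto
  also have "\<dots> = \<zero>" using Suc.prems a by (intro Suc.IH) auto
  also have "ddiff A (\<lambda>x. a \<otimes> x [^] j) = a \<otimes> ddiff A (\<lambda>x. x [^] j)"
    using Suc c by (intro ddiff_scale) auto
  also have "ddiff A (\<lambda>x. x [^] j) = \<zero>" using Suc.prems by (intro Suc.IH) auto
  finally show ?case using c by simp
qed

text \<open>Coefficient lists start with the leading coefficient, so the head of
  \<open>c # p\<close> belongs to the power \<open>length p\<close>, and linearity reduces the claim
  to \<open>ddiff_power\<close>.\<close>

lemma ddiff_eval: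
  assumes "finite A" "A \<subseteq> carrier R" "set p \<subseteq> carrier R" "length p < card A"
  shows "ddiff A (eval p) = \<zero>"
  using assms(3,4)
proof (induction p)
  case Nil
  then show ?case using assms(2) by (simp add: ddiff_def subset_iff cong: finsum_cong)
next
  case (Cons c p)
  have "ddiff A (eval (c # p)) = ddiff A (\<lambda>x. c \<otimes> x [^] length p \<oplus> eval p x)"
    by simp
  also have "\<dots> = ddiff A (\<lambda>x. c \<otimes> x [^] length p) \<oplus> ddiff A (eval p)"
    using Cons assms eval_in_carrier[of p] by (intro ddiff_add) auto
  also have "ddiff A (eval p) = \<zero>" using Cons by simp
  also have "ddiff A (\<lambda>x. c \<otimes> x [^] length p) = c \<otimes> ddiff A (\<lambda>x. x [^] length p)"
    using Cons assms by (intro ddiff_scale) auto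
  also have "ddiff A (\<lambda>x. x [^] length p) = \<zero>"
    using Cons assms by (intro ddiff_power) auto
  finally show ?case using Cons by simp
qed

text \<open>On \<open>insert a A\<close> there are more nodes than coefficients, so the divided
  difference vanishes and can be solved for the term at \<open>a\<close>. The other denominators
  split off \<open>x - a\<close>, written with \<open>nz\<close> because the program reads it from
  its table in this form.\<close>

lemma interpolation:
  assumes "finite A" "A \<subseteq> carrier R" "set p \<subseteq> carrier R" "length p \<le> card A"
    "a \<in> carrier R" "a \<notin> A"
  shows "eval p a =
    \<zero> \<ominus> dprod a A \<otimes> (\<Oplus>x\<in>A. eval p x \<otimes> inv (dprod x A) \<otimes> inv (nz (x \<ominus> a)))"
    (is "_ = \<zero> \<ominus> _ \<otimes> ?s")
proof -
  have ev: "eval p x \<in> carrier R" if "x \<in> carrier R" for x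
    using eval_in_carrier assms that by blast
  have s: "?s \<in> carrier R"
    using assms ev by (intro finsum_closed) (auto simp: subset_iff)
  have t: "eval p x \<otimes> inv (dprod x (insert a A)) =
      eval p x \<otimes> inv (dprod x A) \<otimes> inv (nz (x \<ominus> a))" if "x \<in> A" for x
    using that assms ev[of x]
    by (auto simp: subset_iff dprod_insert inv_mult_nz m_ac)
  have "\<zero> = ddiff (insert a A) (eval p)"
    using assms by (intro ddiff_eval[symmetric]) auto
  also have "\<dots> = eval p a \<otimes> inv (dprod a (insert a A)) \<oplus>
      (\<Oplus>x\<in>A. eval p x \<otimes> inv (dprod x (insert a A)))"
    unfolding ddiff_def using assms ev
    by (intro finsum_insert) (auto simp: subset_iff)
  also have "(\<Oplus>x\<in>A. eval p x \<otimes> inv (dprod x (insert a A))) = ?s"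
    using assms ev by (intro finsum_cong' t) (auto simp: subset_iff)
  also have "dprod a (insert a A) = dprod a A"
    using assms by (intro dprod_insert_self) auto
  finally have sum: "\<zero> = eval p a \<otimes> inv (dprod a A) \<oplus> ?s" .
  have "\<ominus> ?s = eval p a \<otimes> inv (dprod a A)"
    using s ev assms by (intro minus_equality sum[symmetric]) auto
  then have "dprod a A \<otimes> \<ominus> ?s = (dprod a A \<otimes> inv (dprod a A)) \<otimes> eval p a"
    using ev assms by (simp add: m_ac del: mult_inv_cancel)
  then show ?thesis using s ev assms by (simp add: a_minus_def r_minus)
qed

end

section \<open>The points of the field\<close>

text \<open>The \<open>i\<close>-th point in lexicographic order: the bits of \<open>i\<close>, most
  significant first. Unlike \<open>vec_of_int\<close> it is total, so that it enumerates the points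
  without side conditions.\<close>

definition pt :: "nat \<Rightarrow> nat \<Rightarrow> vec" where
  "pt m i = map (bit i) (rev [0..<m])"

lemma length_pt [simp]: "length (pt m i) = m"
  by (simp add: pt_def)

lemma int_less_power: "i < 2 ^ m \<Longrightarrow> int i < 2 ^ m"
  by (metis of_nat_less_iff of_nat_numeral of_nat_power)

lemma vec_of_int_of_nat [simp]: "i < 2 ^ m \<Longrightarrow> vec_of_int m (int i) = Some (pt m i)"
  by (simp add: vec_of_int_def pt_def bit_of_nat_iff_bit int_less_power)

lemma int_of_vec_pt [simp]: "i < 2 ^ m \<Longrightarrow> int_of_vec (pt m i) = int i"
proof -
  assume "i < 2 ^ m"
  have "rev (pt m i) = map (bit (int i)) [0..<m]"
    by (simp add: pt_def rev_map bit_of_nat_iff_bit)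
  then have "int_of_vec (pt m i) = take_bit m (int i)"
    by (simp add: int_of_vec_def horner_sum_bit_eq_take_bit)
  also have "\<dots> = int i"
    using \<open>i < 2 ^ m\<close> by (simp add: take_bit_int_eq_self_iff int_less_power)
  finally show ?thesis .
qed

lemma pt_inject: "i < 2 ^ m \<Longrightarrow> j < 2 ^ m \<Longrightarrow> pt m i = pt m j \<longleftrightarrow> i = j"
  by (metis int_of_vec_pt of_nat_eq_iff)

lemma inj_on_pt: "inj_on (pt m) {..<2 ^ m}"
  by (rule inj_onI) (simp add: pt_inject)

lemma card_vectors: "card {v :: vec. length v = m} = 2 ^ m"
  using card_lists_length_eq[of "UNIV :: bool set" m] by simp

lemma finite_vectors: "finite {v :: vec. length v = m}"
  using finite_lists_length_eq[of "UNIV :: bool set" m] by simp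

text \<open>Both sides have \<open>2 ^ m\<close> elements, since \<open>pt m\<close> is injective on
  these indices.\<close>

lemma image_pt: "pt m ` {..<2 ^ m} = {v. length v = m}"
  using inj_on_pt[of m] by (intro card_subset_eq finite_vectors) (auto simp: card_image card_vectors)

lemma not_bit_of_less: "(v :: nat) < 2 ^ b \<Longrightarrow> b \<le> n \<Longrightarrow> \<not> bit v n"
  by (metis bit_take_bit_iff leD take_bit_nat_eq_self)

text \<open>The low \<open>b\<close> bits of \<open>c\<close> vanish and \<open>v\<close> has no
  others, so the addition produces no carry.\<close>

lemma bit_add_iff_of_dvd:
  assumes "2 ^ b dvd c" "v < 2 ^ b"
  shows "bit (c + v :: nat) n \<longleftrightarrow> bit c n \<noteq> bit v n"
proof -
  obtain d where d: "c = push_bit b d"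
    using assms(1) by (auto simp: push_bit_eq_mult dvd_def mult.commute)
  have "and c v = 0"
    using not_bit_of_less[OF assms(2)]
    by (intro bit_eqI) (auto simp: d bit_and_iff bit_push_bit_iff)
  then show ?thesis by (simp add: disjunctive_add_eq_xor bit_xor_iff)
qed

text \<open>Through this, an aligned interval of \<open>2 ^ b\<close> indices becomes a translate of
  the first \<open>2 ^ b\<close> points, addition in the field being coordinatewise.\<close>

lemma pt_add:
  assumes "2 ^ b dvd c" "v < 2 ^ b"
  shows "pt m (c + v) = map2 (\<noteq>) (pt m c) (pt m v)"
  by (simp add: pt_def map2_map_map bit_add_iff_of_dvd[OF assms])

lemma pt_Suc: "i < 2 ^ m \<Longrightarrow> pt (Suc m) i = False # pt m i"
  by (simp add: pt_def not_bit_of_less)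

lemma pt_Suc_upper:
  assumes "i < 2 ^ m"
  shows "pt (Suc m) (i + 2 ^ m) = True # pt m i"
  unfolding add.commute[of i] using assms by (auto simp: pt_def bit_add_iff_of_dvd[of m] not_bit_of_less bit_exp_iff)

text \<open>The lower half of the indices gets leading coordinate 0 and the upper half 1; both
  halves are otherwise copies of the list for one coordinate fewer.\<close>

lemma sorted_pt: "sorted_wrt (<) (map (pt m) [0..<2 ^ m])"
proof (induction m)
  case 0
  then show ?case by simp
next
  case (Suc m)
  have "[0..<2 ^ Suc m] = [0..<2 ^ m] @ map (\<lambda>i. i + 2 ^ m) [0..<2 ^ m]"
    using upt_add_eq_append[of 0 "2 ^ m" "2 ^ m"] by (simp add: map_add_upt mult_2)
  then have "map (pt (Suc m)) [0..<2 ^ Suc m] =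
      map (Cons False) (map (pt m) [0..<2 ^ m]) @ map (Cons True) (map (pt m) [0..<2 ^ m])"
    by (simp add: pt_Suc pt_Suc_upper)
  then show ?case
    using Suc by (auto simp: sorted_wrt_append sorted_wrt_map)
qed

lemma points_eq: "points m = map (pt m) [0..<2 ^ m]"
proof -
  have "set (map (pt m) [0..<2 ^ m]) = {v. length v = m}"
    by (simp only: set_map set_upt atLeast0LessThan image_pt)
  then show ?thesis
    unfolding points_def
    using sorted_list_of_set.idem_if_sorted_distinct[of "map (pt m) [0..<2 ^ m]"] sorted_pt[of m]
    by (simp add: strict_sorted_iff)
qed

section \<open>Weakest preconditions with running times\<close>

text \<open>Total correctness: a run has to exist. Undefined operations and overflowing integers
  admit no run, so proofs about \<open>wp\<close> exclude these as well. The postcondition also sees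
  the running time.\<close>

definition wp :: "nat \<Rightarrow> vec ring \<Rightarrow> nat \<Rightarrow> com \<Rightarrow> state \<Rightarrow> (nat \<Rightarrow> state \<Rightarrow> bool) \<Rightarrow> bool" where
  "wp m F w c s Q \<longleftrightarrow> (\<exists>T s'. exec m F w c s T s' \<and> Q T s')"


inductive_cases exec_SkipE: "exec m F w Skip s T s'"
inductive_cases exec_IAssignE: "exec m F w (IAssign x e) s T s'"
inductive_cases exec_IWriteE: "exec m F w (IWrite a d e) s T s'"
inductive_cases exec_FAssignE: "exec m F w (FAssign x e) s T s'"
inductive_cases exec_FWriteE: "exec m F w (FWrite a d e) s T s'"
inductive_cases exec_SeqE: "exec m F w (Seq c d) s T s'"
inductive_cases exec_CondE: "exec m F w (Cond b c d) s T s'"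

lemma wp_Skip [simp]: "wp m F w Skip s Q \<longleftrightarrow> Q 1 s"
  unfolding wp_def by (auto intro: exec.Skip[simplified] elim: exec_SkipE)

lemma wp_IAssign [simp]:
  "wp m F w (IAssign x e) s Q \<longleftrightarrow>
    (case ieval m F w s e of None \<Rightarrow> False
     | Some n \<Rightarrow> Q (1 + icost e) (s\<lparr>ivar := (ivar s)(x := n)\<rparr>))"
  unfolding wp_def
  by (fastforce split: option.splits intro: exec.IAssign[simplified] elim: exec_IAssignE)

lemma wp_IWrite [simp]:
  "wp m F w (IWrite a d e) s Q \<longleftrightarrow>
    (case ieval m F w s d \<bind> address of None \<Rightarrow> False
     | Some i \<Rightarrow> case ieval m F w s e of None \<Rightarrow> False
       | Some n \<Rightarrow> Q (1 + icost d + icost e) (s\<lparr>iarr := (iarr s)(a := (iarr s a)(i := n))\<rparr>))"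
  unfolding wp_def
  by (fastforce split: option.splits Option.bind_splits intro: exec.IWrite[simplified] elim!: exec_IWriteE)

lemma wp_FAssign [simp]:
  "wp m F w (FAssign x e) s Q \<longleftrightarrow>
    (case feval m F w s e of None \<Rightarrow> False
     | Some v \<Rightarrow> Q (1 + fcost e) (s\<lparr>fvar := (fvar s)(x := v)\<rparr>))"
  unfolding wp_def
  by (fastforce split: option.splits intro: exec.FAssign[simplified] elim: exec_FAssignE)

lemma wp_FWrite [simp]:
  "wp m F w (FWrite a d e) s Q \<longleftrightarrow>
    (case ieval m F w s d \<bind> address of None \<Rightarrow> False
     | Some i \<Rightarrow> case feval m F w s e of None \<Rightarrow> False
       | Some v \<Rightarrow> Q (1 + icost d + fcost e) (s\<lparr>farr := (farr s)(a := (farr s a)(i := v))\<rparr>))"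
  unfolding wp_def
  by (fastforce split: option.splits Option.bind_splits intro: exec.FWrite[simplified] elim!: exec_FWriteE)

lemma wp_Seq [simp]:
  "wp m F w (Seq c d) s Q \<longleftrightarrow> wp m F w c s (\<lambda>T1 s1. wp m F w d s1 (\<lambda>T2. Q (T1 + T2)))"
  unfolding wp_def by (blast intro: exec.Seq elim: exec_SeqE)

lemma wp_Cond [simp]:
  "wp m F w (Cond b c d) s Q \<longleftrightarrow>
    (case beval m F w s b of None \<Rightarrow> False
     | Some v \<Rightarrow> wp m F w (if v then c else d) s (\<lambda>T. Q (1 + bcost b + T)))"
  (is "?L \<longleftrightarrow> ?R")
proof
  assume ?L
  then obtain T s' where "exec m F w (Cond b c d) s T s'" "Q T s'" unfolding wp_def by blast
  then show ?R by (elim exec_CondE) (auto simp: wp_def)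
next
  assume ?R
  then obtain v T s' where *: "beval m F w s b = Some v" "exec m F w (if v then c else d) s T s'"
    "Q (1 + bcost b + T) s'"
    by (auto simp: wp_def split: option.splits)
  then have "exec m F w (Cond b c d) s (1 + bcost b + T) s'"
    by (cases v) (auto intro: exec.CondTrue[simplified] exec.CondFalse[simplified])
  then show ?L using *(3) unfolding wp_def by blast
qed

text \<open>Keeps the simplifier from executing the continuation \<open>Q\<close> in an unknown state.\<close>

lemma wp_weak_cong [cong]: "s = s' \<Longrightarrow> wp m F w c s Q \<longleftrightarrow> wp m F w c s' Q"
  by simp

lemma wp_mono:
  "wp m F w c s Q \<Longrightarrow> (\<And>T s'. Q T s' \<Longrightarrow> Q' T s') \<Longrightarrow> wp m F w c s Q'"
  unfolding wp_def by blast

text \<open>Induction on the number of rounds left. The extra round in the bound pays for the final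
  failing test.\<close>

lemma wp_While_counted:
  assumes "I i s" "i \<le> N"
    and test: "\<And>i s. I i s \<Longrightarrow> i \<le> N \<Longrightarrow> beval m F w s b = Some (i < N)"
    and body: "\<And>i s. I i s \<Longrightarrow> i < N \<Longrightarrow> wp m F w c s (\<lambda>T s'. T \<le> B \<and> I (Suc i) s')"
  shows "wp m F w (While b c) s (\<lambda>T s'. T \<le> (N - i + 1) * (1 + bcost b + B) \<and> I N s')"
  using assms(1,2)
proof (induction "N - i" arbitrary: i s)
  case 0
  then have "beval m F w s b = Some False" using test[of i s] by simp
  from exec.WhileFalse[OF this] show ?case
    using 0 unfolding wp_def by fastforce
next
  case (Suc n)
  then have i: "i < N" by simp
  then have b: "beval m F w s b = Some True" using test[of i s] Suc.prems by simp
  obtain T1 s1 where 1: "exec m F w c s T1 s1" "T1 \<le> B" "I (Suc i) s1"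
    using body[OF Suc.prems(1) i] unfolding wp_def by blast
  have "n = N - Suc i" using Suc.hyps(2) by simp
  from Suc.hyps(1)[OF this 1(3)] i
  obtain T2 s2 where 2: "exec m F w (While b c) s1 T2 s2"
      "T2 \<le> (N - Suc i + 1) * (1 + bcost b + B)" "I N s2"
    unfolding wp_def by auto
  have "N - i + 1 = Suc (N - Suc i + 1)" using i by simp
  then have "1 + bcost b + T1 + T2 \<le> (N - i + 1) * (1 + bcost b + B)"
    using 1 2 by simp
  then show ?case
    using exec.WhileTrue[OF b 1(1) 2(1)] 2(3) unfolding wp_def by blast
qed

definition for_less :: "string \<Rightarrow> iexp \<Rightarrow> com \<Rightarrow> com" where
  "for_less x e c =
     Seq (IAssign x (IConst 0))
       (While (ILess (IVar x) e) (Seq c (IAssign x (IOp IAdd (IVar x) (IConst 1)))))"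

text \<open>The bound expression is evaluated at every test, also the last one, so
  \<open>bound\<close> covers \<open>i = N\<close>. A round costs \<open>B\<close> for the body, 4
  for the increment and \<open>3 + icost e\<close> for the test; the remaining 2 of the constant 9
  absorb the initial assignment.\<close>

lemma wp_for_less:
  fixes I :: "nat \<Rightarrow> state \<Rightarrow> bool"
  assumes start: "I 0 (s\<lparr>ivar := (ivar s)(x := 0)\<rparr>)"
    and bound: "\<And>i s. i \<le> N \<Longrightarrow> I i s \<Longrightarrow> ivar s x = int i \<Longrightarrow> ieval m F w s e = Some (int N)"
    and body: "\<And>i s. i < N \<Longrightarrow> I i s \<Longrightarrow> ivar s x = int i \<Longrightarrow>
      wp m F w c s (\<lambda>T s'. T \<le> B \<and> ivar s' x = int i \<and>
        I (Suc i) (s'\<lparr>ivar := (ivar s')(x := int (Suc i))\<rparr>))"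
    and N: "int N < 2 ^ w" and w: "0 < w"
    and Q: "\<And>T s'. T \<le> (N + 1) * (B + icost e + 9) \<Longrightarrow> I N s' \<Longrightarrow> Q T s'"
  shows "wp m F w (for_less x e c) s Q"
proof -
  have one: "(1 :: int) < 2 ^ w" using w by (metis one_less_numeral_iff one_less_power semiring_norm(76))
  define J where "J i s \<longleftrightarrow> I i s \<and> ivar s x = int i" for i s
  let ?b = "ILess (IVar x) e"
  let ?c = "Seq c (IAssign x (IOp IAdd (IVar x) (IConst 1)))"
  have "wp m F w (While ?b ?c) (s\<lparr>ivar := (ivar s)(x := 0)\<rparr>)
    (\<lambda>T s'. T \<le> (N - 0 + 1) * (1 + bcost ?b + (B + 4)) \<and> J N s')"
  proof (rule wp_While_counted)
    show "J 0 (s\<lparr>ivar := (ivar s)(x := 0)\<rparr>)" using start by (simp add: J_def)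
    fix i s assume J: "J i s"
    show "beval m F w s ?b = Some (i < N)" if "i \<le> N"
      using bound[of i s] that J by (simp add: J_def)
    assume i: "i < N"
    have succ: "1 + int i < 2 ^ w" using i N by linarith
    show "wp m F w ?c s (\<lambda>T s'. T \<le> B + 4 \<and> J (Suc i) s')"
    proof (subst wp_Seq, rule wp_mono[OF body[OF i]])
      fix T s' assume "T \<le> B \<and> ivar s' x = int i \<and>
        I (Suc i) (s'\<lparr>ivar := (ivar s')(x := int (Suc i))\<rparr>)"
      then show "wp m F w (IAssign x (IOp IAdd (IVar x) (IConst 1))) s'
          (\<lambda>T2 s2. T + T2 \<le> B + 4 \<and> J (Suc i) s2)"
        using one succ by (simp add: J_def word_def add.commute)
    qed (use J in \<open>auto simp: J_def\<close>)
  qed simp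
  then show ?thesis
    unfolding for_less_def using one
    by (auto simp: word_def J_def algebra_simps intro!: Q elim!: wp_mono)
qed

section \<open>The choice of the interpolation points\<close>

text \<open>The programs are defined outside this locale, so they cannot depend on the parameters
  collected here. Counting coefficients by \<open>length P\<close> treats the zero polynomial like
  any other.\<close>

locale erasure_decoding = field F for F :: "vec ring" (structure) +
  fixes m k :: nat and P :: "vec list" and xs :: "vec list"
  assumes m: "1 \<le> m" and k: "1 \<le> k" "k \<le> 2 ^ m"
    and carrier_F: "carrier F = {v. length v = m}"
    and add_F: "\<And>u v. u \<in> carrier F \<Longrightarrow> v \<in> carrier F \<Longrightarrow> u \<oplus> v = map2 (\<noteq>) u v"
    and P: "set P \<subseteq> carrier F" "length P \<le> k"
    and xs: "distinct xs" "set xs \<subseteq> carrier F" "k \<le> length xs"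
begin

abbreviation q :: nat where "q \<equiv> 2 ^ m"
abbreviation pnt :: "nat \<Rightarrow> vec" where "pnt \<equiv> pt m"

section \<open>Numbering of the field elements\<close>

lemma pt_closed [simp]: "pnt i \<in> carrier F"
  by (simp add: carrier_F)

lemma image_pt_subset [simp]: "pnt ` A \<subseteq> carrier F"
  by auto

lemma eval_closed [simp]: "x \<in> carrier F \<Longrightarrow> eval P x \<in> carrier F"
  using eval_in_carrier P(1) by blast

definition idx :: "vec \<Rightarrow> nat" where "idx v = nat (int_of_vec v)"

lemma idx_pt [simp]: "i < q \<Longrightarrow> idx (pnt i) = i"
  by (simp add: idx_def)

lemma carrier_ptE:
  assumes "x \<in> carrier F" obtains i where "i < q" "x = pnt i"
  using assms image_pt[of m] by (auto simp: carrier_F)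

lemma int_of_vec_eq_idx [simp]: "x \<in> carrier F \<Longrightarrow> int_of_vec x = int (idx x)"
  by (metis carrier_ptE idx_pt int_of_vec_pt)

lemma idx_less [simp]: "x \<in> carrier F \<Longrightarrow> idx x < q"
  by (metis carrier_ptE idx_pt)

lemma pt_idx [simp]: "x \<in> carrier F \<Longrightarrow> pnt (idx x) = x"
  by (metis carrier_ptE idx_pt)

lemma pt_add_field: "2 ^ b dvd c \<Longrightarrow> v < 2 ^ b \<Longrightarrow> pnt (c + v) = pnt c \<oplus> pnt v"
  by (simp add: add_F pt_add)

text \<open>Adding the index 0 to itself produces no carry, and only zero is idempotent for the
  field addition.\<close>

lemma pt_0: "pnt 0 = \<zero>"
proof -
  have "pnt 0 \<oplus> pnt 0 = pnt 0" using pt_add_field[of 0 0 0] by simp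
  then show ?thesis by simp
qed

section \<open>Products over intervals of points and over subspaces\<close>

abbreviation block :: "nat \<Rightarrow> nat \<Rightarrow> vec set" where
  "block i j \<equiv> pnt ` {i..<j}"

lemma finite_pts: "finite (carrier F)"
  by (simp add: carrier_F finite_vectors)

lemma dprod_block_split:
  assumes "i \<le> j" "j \<le> l" "l \<le> q" "x \<in> carrier F"
  shows "dprod x (block i l) = dprod x (block i j) \<otimes> dprod x (block j l)"
proof -
  have "{i..<l} = {i..<j} \<union> {j..<l}" using assms by auto
  moreover have "block i j \<inter> block j l = {}"
    using assms inj_on_image_Int[OF inj_on_pt[of m], of "{i..<j}" "{j..<l}"] by fastforce
  ultimately show ?thesis
    using assms dprod_Un[of "block i j" "block j l" x] by (simp add: image_Un)
qed

text \<open>The interval is the translate by \<open>pnt c\<close> of the first \<open>2 ^ b\<close>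
  points. The differences themselves coincide, so \<open>nz\<close> replaces the same factors on
  both sides.\<close>

lemma dprod_block_shift:
  assumes "2 ^ b dvd c" "c + 2 ^ b \<le> q" "x \<in> carrier F"
  shows "dprod x (block c (c + 2 ^ b)) = dprod (x \<ominus> pnt c) (block 0 (2 ^ b))"
proof -
  have shift: "x \<ominus> pnt (c + v) = x \<ominus> pnt c \<ominus> pnt v" if "v < 2 ^ b" for v
    using assms(3) by (simp add: pt_add_field[OF assms(1) that] a_minus_def minus_add a_assoc)
  have inj: "inj_on (\<lambda>v. pnt (c + v)) {0..<2 ^ b}" "inj_on pnt {0..<2 ^ b}"
    using assms(2) by (auto intro!: inj_onI simp: pt_inject)
  have "block c (c + 2 ^ b) = (\<lambda>v. pnt (c + v)) ` {0..<2 ^ b}"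
    using image_add_atLeastLessThan[of c 0 "2 ^ b"] image_image[of pnt "(+) c" "{0..<2 ^ b}"]
    by (simp add: add.commute)
  then have "dprod x (block c (c + 2 ^ b)) = (\<Otimes>v\<in>{0..<2 ^ b}. nz (x \<ominus> pnt (c + v)))"
    unfolding dprod_def using assms(3)
    by (simp only:) (intro finprod_reindex inj(1), auto)
  also have "\<dots> = (\<Otimes>v\<in>{0..<2 ^ b}. nz (x \<ominus> pnt c \<ominus> pnt v))"
    using assms(3) by (intro finprod_cong') (auto simp: shift)
  also have "\<dots> = dprod (x \<ominus> pnt c) (block 0 (2 ^ b))"
    unfolding dprod_def using assms(3)
    by (intro finprod_reindex[symmetric] inj(2)) auto
  finally show ?thesis .
qed

text \<open>Off the first \<open>2 ^ b\<close> points, which form a subspace for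
  \<open>b \<le> m\<close>, this is the value of the subspace polynomial; on them the vanishing
  factor is dropped.\<close>

definition subspace_prod :: "nat \<Rightarrow> vec \<Rightarrow> vec" where
  "subspace_prod b x = dprod x (block 0 (2 ^ b))"

lemma subspace_prod_closed [simp]: "x \<in> carrier F \<Longrightarrow> subspace_prod b x \<in> carrier F"
  by (simp add: subspace_prod_def)

text \<open>The subspace is zero here. Row 0 of the table therefore holds \<open>nz\<close>, and the
  later loops read \<open>nz\<close> from it instead of branching.\<close>

lemma subspace_prod_0: "x \<in> carrier F \<Longrightarrow> subspace_prod 0 x = nz x"
  by (simp add: subspace_prod_def dprod_insert pt_0 a_minus_def)

text \<open>The first \<open>2 ^ (b + 1)\<close> points split into the first \<open>2 ^ b\<close>
  ones and their translate by \<open>pnt (2 ^ b)\<close>, so each new table entry costs one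
  multiplication.\<close>

lemma subspace_prod_Suc:
  assumes "b < m" "x \<in> carrier F"
  shows "subspace_prod (Suc b) x = subspace_prod b x \<otimes> subspace_prod b (x \<ominus> pnt (2 ^ b))"
proof -
  have le: "(2::nat) ^ b + 2 ^ b \<le> q"
    using assms(1) power_increasing[of "Suc b" m "2::nat"] by simp
  show ?thesis
    unfolding subspace_prod_def
    using dprod_block_split[of 0 "2 ^ b" "2 ^ b + 2 ^ b" x] dprod_block_shift[of b "2 ^ b" x]
      assms(2) le
    by (simp add: mult_2)
qed

text \<open>The set bits of \<open>k\<close> cut the first \<open>k\<close> points into translates of subspaces.\<close>

definition cut :: "nat \<Rightarrow> nat" where "cut b = k - take_bit b k"

lemma cut_le: "cut b \<le> k" by (simp add: cut_def)

lemma cut_0: "cut 0 = k" by (simp add: cut_def)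

lemma cut_Suc: "cut b = cut (Suc b) + of_bool (bit k b) * 2 ^ b"
proof -
  have "take_bit (Suc b) k = 2 ^ b * of_bool (bit k b) + take_bit b k"
    by (rule take_bit_Suc_from_most)
  moreover have "take_bit (Suc b) k \<le> k" by (rule take_bit_nat_less_eq_self)
  ultimately show ?thesis by (simp add: cut_def)
qed

lemma cut_dvd: "2 ^ b dvd cut b"
  by (simp add: cut_def take_bit_eq_mod minus_mod_eq_mult_div)

text \<open>The index is \<open>m + 1\<close> because \<open>k = 2 ^ m\<close> is allowed and has
  its only set digit at position \<open>m\<close>.\<close>

lemma cut_m: "cut (Suc m) = 0"
  using k by (simp add: cut_def take_bit_nat_eq_self)


section \<open>Interpolation nodes, missing points and extra points\<close>

definition known_upto :: "nat \<Rightarrow> vec list" where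
  "known_upto i = take k (filter (\<lambda>v. v \<in> set xs) (map pnt [0..<i]))"

text \<open>Both lists are indexed by a prefix of the points so that they can state the loop
  invariant of \<open>split_prog\<close>.\<close>

definition missing_upto :: "nat \<Rightarrow> vec list" where
  "missing_upto i = filter (\<lambda>v. v \<notin> set xs) (map pnt [0..<min i k])"

abbreviation nodes :: "vec list" where "nodes \<equiv> known_upto q"
abbreviation missing :: "vec list" where "missing \<equiv> missing_upto q"
abbreviation num_missing :: nat where "num_missing \<equiv> length missing"

text \<open>The nodes are listed in the order of the points, so those outside the first
  \<open>k\<close> points form the tail; the program finds them in the array of nodes by an
  offset.\<close>

definition extra :: "vec list" where "extra = drop (k - num_missing) nodes"

lemma distinct_pts: "i \<le> q \<Longrightarrow> distinct (map pnt [0..<i])"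
  by (auto simp: distinct_map intro: inj_on_subset[OF inj_on_pt])

lemma set_pts: "set (map pnt [0..<q]) = carrier F"
  using image_pt[of m] by (simp add: carrier_F atLeast0LessThan)

lemma known_upto_0: "known_upto 0 = []" by (simp add: known_upto_def)

lemma missing_upto_0: "missing_upto 0 = []" by (simp add: missing_upto_def)

lemma known_upto_Suc:
  "known_upto (Suc i) =
    (if pnt i \<in> set xs \<and> length (known_upto i) < k then known_upto i @ [pnt i] else known_upto i)"
  by (auto simp: known_upto_def)

lemma missing_upto_Suc:
  "missing_upto (Suc i) =
    (if pnt i \<notin> set xs \<and> i < k then missing_upto i @ [pnt i] else missing_upto i)"
  by (auto simp: missing_upto_def min_def not_less_eq_eq le_Suc_eq)

lemma length_known_upto: "length (known_upto i) \<le> k"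
  by (simp add: known_upto_def)

lemma length_missing_upto: "length (missing_upto i) \<le> k"
  unfolding missing_upto_def by (rule order_trans[OF length_filter_le]) simp

lemma missing_eq: "missing = filter (\<lambda>v. v \<notin> set xs) (map pnt [0..<k])"
  using k by (simp add: missing_upto_def min_absorb2)

lemma distinct_missing: "distinct missing"
  unfolding missing_eq using distinct_pts[of k] k by simp

lemma set_missing: "set missing = block 0 k - set xs"
  by (auto simp: missing_eq)

lemma distinct_nodes: "distinct nodes"
  unfolding known_upto_def using distinct_pts[of q] by simp

lemma nodes_known: "set nodes \<subseteq> set xs"
  unfolding known_upto_def by (auto dest: in_set_takeD)

lemma set_nodes: "set nodes \<subseteq> carrier F"
  using nodes_known xs(2) by blast

text \<open>All known points are field elements, so the scan meets each of them, and there are at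
  least \<open>k\<close>.\<close>

lemma length_nodes: "length nodes = k"
proof -
  let ?f = "filter (\<lambda>v. v \<in> set xs) (map pnt [0..<q])"
  have "set ?f = set xs" using set_pts xs(2) by auto
  then have "length ?f = length xs"
    using distinct_pts[of q] xs(1) by (metis distinct_card distinct_filter order_refl)
  then show ?thesis using xs(3) by (simp add: known_upto_def)
qed

text \<open>Exactly \<open>k - num_missing\<close> of the first \<open>k\<close> points are known,
  so the truncation to \<open>k\<close> entries keeps them all, and they come first.\<close>

lemma take_nodes: "take (k - num_missing) nodes = filter (\<lambda>v. v \<in> set xs) (map pnt [0..<k])"
proof -
  let ?S = "map pnt [0..<k]" and ?K = "\<lambda>v. v \<in> set xs"
  have "[0..<q] = [0..<k] @ [k..<q]" using k(2) by (metis le_add_diff_inverse upt_add_eq_append zero_le)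
  then have n: "nodes = take k (filter ?K ?S @ filter ?K (map pnt [k..<q]))"
    by (simp add: known_upto_def)
  have "length (filter ?K ?S) + num_missing = k"
    unfolding missing_eq using sum_length_filter_compl[of ?K ?S] by simp
  then have "length (filter ?K ?S) = k - num_missing" by simp
  then show ?thesis by (simp add: n)
qed

lemma length_extra: "length extra = num_missing"
  using length_missing_upto[of q] by (simp add: extra_def length_nodes)

lemma extra_nth: "l < num_missing \<Longrightarrow> nodes ! (k - num_missing + l) = extra ! l"
  using length_missing_upto[of q] by (simp add: extra_def length_nodes)

lemma set_extra: "set extra \<subseteq> carrier F"
  using set_nodes set_drop_subset[of "k - num_missing" nodes] by (auto simp: extra_def)

lemma set_missing_carrier: "set missing \<subseteq> carrier F"
  by (auto simp: set_missing)

lemma distinct_extra: "distinct extra"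
  using distinct_nodes by (simp add: extra_def)

lemma nodes_eq: "set nodes = (block 0 k \<inter> set xs) \<union> set extra" "block 0 k \<inter> set extra = {}"
proof -
  have n: "nodes = filter (\<lambda>v. v \<in> set xs) (map pnt [0..<k]) @ extra"
    unfolding extra_def take_nodes[symmetric] by simp
  then show "set nodes = (block 0 k \<inter> set xs) \<union> set extra" by (subst n) auto
  have "set (filter (\<lambda>v. v \<in> set xs) (map pnt [0..<k])) \<inter> set extra = {}"
    using distinct_nodes by (subst (asm) n) (simp only: distinct_append)
  moreover have "set extra \<subseteq> set xs"
    using nodes_known n by (metis Un_iff set_append subset_iff)
  ultimately show "block 0 k \<inter> set extra = {}" by fastforce
qed

text \<open>\<open>nodes\<close> with \<open>missing\<close> and the first \<open>k\<close> points
  with \<open>extra\<close> have the same union, and both unions are disjoint. A weight thus needs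
  the product over the first \<open>k\<close> points, available from the table, and two products of
  \<open>num_missing\<close> factors.\<close>

lemma dprod_nodes:
  assumes "x \<in> carrier F"
  shows "dprod x (block 0 k) \<otimes> dprod x (set extra) \<otimes> inv (dprod x (set missing)) = dprod x (set nodes)"
proof (rule mult_inv_eqI)
  have "set nodes \<union> set missing = block 0 k \<union> set extra"
    using nodes_eq by (auto simp: set_missing)
  moreover have "set nodes \<inter> set missing = {}"
    using nodes_known by (auto simp: set_missing)
  ultimately show "dprod x (block 0 k) \<otimes> dprod x (set extra) =
      dprod x (set nodes) \<otimes> dprod x (set missing)"
    using assms set_nodes set_extra set_missing_carrier nodes_eq(2)
      dprod_Un[of "set nodes" "set missing" x] dprod_Un[of "block 0 k" "set extra" x]
    by simp
qed (use assms set_nodes set_extra set_missing_carrier in auto)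

section \<open>Weights of the nodes and partial interpolation sums\<close>

lemma take_carrier: "set vs \<subseteq> carrier F \<Longrightarrow> set (take l vs) \<subseteq> carrier F"
  using set_take_subset[of l vs] by blast

text \<open>The accumulator after \<open>l\<close> rounds of \<open>weight_prog\<close>, which
  multiplies and divides in turn and so gets by with a single register.\<close>

definition partial_weight :: "vec \<Rightarrow> nat \<Rightarrow> vec" where
  "partial_weight x l = dprod x (block 0 k) \<otimes> dprod x (set (take l extra)) \<otimes>
     inv (dprod x (set (take l missing)))"

lemma dprod_take_Suc:
  assumes "distinct vs" "set vs \<subseteq> carrier F" "l < length vs" "x \<in> carrier F"
  shows "dprod x (set (take (Suc l) vs)) = nz (x \<ominus> vs ! l) \<otimes> dprod x (set (take l vs))"
proof -
  have "vs ! l \<notin> set (take l vs)"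
    using assms(1,3) by (simp add: in_set_conv_nth nth_eq_iff_index_eq)
  moreover have "set (take l vs) \<subseteq> carrier F" using assms(2) set_take_subset[of l vs] by blast
  ultimately show ?thesis
    using assms by (simp add: take_Suc_conv_app_nth dprod_insert subset_iff)
qed

lemma partial_weight_closed [simp]: "x \<in> carrier F \<Longrightarrow> partial_weight x l \<in> carrier F"
  unfolding partial_weight_def
  by (intro m_closed dprod_closed inv_closed_nz dprod_nonzero image_pt_subset take_carrier
      set_extra set_missing_carrier)

lemma partial_weight_0: "x \<in> carrier F \<Longrightarrow> partial_weight x 0 = dprod x (block 0 k)"
  by (simp add: partial_weight_def)

lemma partial_weight_Suc:
  assumes "x \<in> carrier F" "l < num_missing"
  shows "partial_weight x (Suc l) =
    partial_weight x l \<otimes> nz (x \<ominus> extra ! l) \<otimes> inv (nz (x \<ominus> missing ! l))"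
proof -
  let ?D = "dprod x (block 0 k)" and ?A = "dprod x (set (take l extra))"
    and ?B = "dprod x (set (take l missing))" and ?u = "nz (x \<ominus> extra ! l)"
    and ?v = "nz (x \<ominus> missing ! l)"
  have l: "l < length extra" using assms(2) by (simp add: length_extra)
  have e: "extra ! l \<in> carrier F" "missing ! l \<in> carrier F"
    using nth_mem[OF l] nth_mem[OF assms(2)] set_extra set_missing_carrier by auto
  have c: "?D \<in> carrier F" "?A \<in> carrier F" "?B \<in> carrier F" "?B \<noteq> \<zero>" "?u \<in> carrier F" "?v \<in> carrier F"
    using assms(1) e take_carrier[OF set_extra] take_carrier[OF set_missing_carrier] by simp_all
  have "partial_weight x (Suc l) = ?D \<otimes> (?u \<otimes> ?A) \<otimes> (inv ?v \<otimes> inv ?B)"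
    unfolding partial_weight_def
      dprod_take_Suc[OF distinct_extra set_extra l assms(1)]
      dprod_take_Suc[OF distinct_missing set_missing_carrier assms(2,1)]
    using c by (subst inv_mult_nz) simp_all
  also have "\<dots> = ?D \<otimes> ?A \<otimes> inv ?B \<otimes> ?u \<otimes> inv ?v"
    using c by (simp add: m_ac)
  finally show ?thesis unfolding partial_weight_def .
qed

lemma partial_weight_full: "x \<in> carrier F \<Longrightarrow> partial_weight x num_missing = dprod x (set nodes)"
  using dprod_nodes[of x] length_extra by (simp add: partial_weight_def)

text \<open>This factor does not depend on the missing point; it is computed once for each node and
  shared by all missing symbols.\<close>

definition weighted :: "nat \<Rightarrow> vec" where
  "weighted j = eval P (nodes ! j) \<otimes> inv (dprod (nodes ! j) (set nodes))"

lemma nodes_nth [simp]: "j < k \<Longrightarrow> nodes ! j \<in> carrier F"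
  using nth_mem[of j nodes] set_nodes length_nodes by auto

lemma missing_nth [simp]: "l < num_missing \<Longrightarrow> missing ! l \<in> carrier F"
  using nth_mem[of l missing] set_missing_carrier by auto

lemma extra_nth_closed [simp]: "l < num_missing \<Longrightarrow> extra ! l \<in> carrier F"
  using nth_mem[of l extra] set_extra length_extra by auto

lemma weighted_closed [simp]: "j < k \<Longrightarrow> weighted j \<in> carrier F"
  by (simp add: weighted_def set_nodes)

definition partial_sum :: "vec \<Rightarrow> nat \<Rightarrow> vec" where
  "partial_sum a j = (\<Oplus>i\<in>{..<j}. weighted i \<otimes> inv (nz (nodes ! i \<ominus> a)))"

lemma partial_sum_0 [simp]: "partial_sum a 0 = \<zero>"
  by (simp add: partial_sum_def)

lemma partial_sum_closed [simp]:
  "a \<in> carrier F \<Longrightarrow> j \<le> k \<Longrightarrow> partial_sum a j \<in> carrier F"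
  unfolding partial_sum_def by (intro finsum_closed) auto

lemma partial_sum_Suc:
  assumes "a \<in> carrier F" "j < k"
  shows "partial_sum a (Suc j) = partial_sum a j \<oplus> weighted j \<otimes> inv (nz (nodes ! j \<ominus> a))"
proof -
  have "partial_sum a (Suc j) = weighted j \<otimes> inv (nz (nodes ! j \<ominus> a)) \<oplus> partial_sum a j"
    unfolding partial_sum_def lessThan_Suc using assms by (intro finsum_insert) auto
  then show ?thesis using assms by (simp add: a_comm)
qed

text \<open>All nodes are known and a missing point is not, so \<open>interpolation\<close> applies;
  the sum over the set of nodes is then reindexed by positions, in which the program runs through
  them.\<close>

lemma eval_missing:
  assumes "l < num_missing"
  shows "eval P (missing ! l) =
    \<zero> \<ominus> dprod (missing ! l) (set nodes) \<otimes> partial_sum (missing ! l) k"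
proof -
  let ?a = "missing ! l"
  let ?g = "\<lambda>x. eval P x \<otimes> inv (dprod x (set nodes)) \<otimes> inv (nz (x \<ominus> ?a))"
  have a: "?a \<in> carrier F" "?a \<notin> set nodes"
    using assms nth_mem[OF assms] nodes_known by (auto simp: set_missing)
  have im: "set nodes = (!) nodes ` {..<k}"
    using length_nodes by (auto simp: set_conv_nth)
  have inj: "inj_on ((!) nodes) {..<k}"
    using length_nodes distinct_nodes by (auto intro!: inj_onI simp: nth_eq_iff_index_eq)
  have "?g \<in> set nodes \<rightarrow> carrier F"
    using a(1) set_nodes by (intro funcsetI) (simp add: subset_iff)
  then have "(\<Oplus>x\<in>set nodes. ?g x) = (\<Oplus>j\<in>{..<k}. ?g (nodes ! j))"
    unfolding im by (intro finsum_reindex inj) simp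
  also have "\<dots> = partial_sum ?a k"
    by (simp add: partial_sum_def weighted_def)
  finally show ?thesis
    using interpolation[of "set nodes" P ?a] a set_nodes P distinct_card[OF distinct_nodes]
    by (simp add: length_nodes)
qed

end

section \<open>The program\<close>

text \<open>\<open>Index\<close> turns a point into an address, which makes membership in the known
  set and the value there available in constant time.\<close>

definition scan_prog :: com where
  "scan_prog = for_less ''i'' (IVar ''n'')
     (Seq (IWrite ''known'' (Index (FRead ''points'' (IVar ''i''))) (IConst 1))
       (FWrite ''known values'' (Index (FRead ''points'' (IVar ''i''))) (FRead ''values'' (IVar ''i''))))"

definition size_prog :: com where
  "size_prog = Seq (IAssign ''q'' (IConst 1))
     (for_less ''i'' (IVar ''m'') (IAssign ''q'' (IOp IAdd (IVar ''q'') (IVar ''q''))))"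

definition split_prog :: com where
  "split_prog = for_less ''i'' (IVar ''q'')
     (Cond (IEq (IRead ''known'' (IVar ''i'')) (IConst 1))
       (Seq (FWrite ''symbols'' (IVar ''i'') (FRead ''known values'' (IVar ''i'')))
         (Cond (ILess (IVar ''s'') (IVar ''k''))
           (Seq (FWrite ''nodes'' (IVar ''s'') (Point (IVar ''i'')))
             (IAssign ''s'' (IOp IAdd (IVar ''s'') (IConst 1))))
           Skip))
       (Cond (ILess (IVar ''i'') (IVar ''k''))
         (Seq (FWrite ''missing'' (IVar ''t'') (Point (IVar ''i'')))
           (IAssign ''t'' (IOp IAdd (IVar ''t'') (IConst 1))))
         Skip))"

definition first_row_prog :: com where
  "first_row_prog = for_less ''i'' (IVar ''q'')
     (Cond (FEq (Point (IVar ''i'')) FZero)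
       (FWrite ''table'' (IVar ''i'') FOne)
       (FWrite ''table'' (IVar ''i'') (Point (IVar ''i''))))"

text \<open>The table is stored row by row: \<open>row\<close> is the start of row \<open>b\<close>
  and \<open>p\<close> is \<open>2 ^ b\<close>, both advanced by additions.\<close>

definition next_row_prog :: com where
  "next_row_prog = for_less ''i'' (IVar ''q'')
     (FWrite ''table'' (IOp IAdd (IOp IAdd (IVar ''row'') (IVar ''q'')) (IVar ''i''))
       (FOp FMul (FRead ''table'' (IOp IAdd (IVar ''row'') (IVar ''i'')))
         (FRead ''table'' (IOp IAdd (IVar ''row'')
           (Index (FOp FSub (Point (IVar ''i'')) (Point (IVar ''p''))))))))"

definition advance_prog :: com where
  "advance_prog = Seq (IAssign ''row'' (IOp IAdd (IVar ''row'') (IVar ''q'')))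
     (IAssign ''p'' (IOp IAdd (IVar ''p'') (IVar ''p'')))"

definition table_prog :: com where
  "table_prog = Seq first_row_prog
     (Seq (IAssign ''row'' (IConst 0))
     (Seq (IAssign ''p'' (IConst 1))
       (for_less ''b'' (IVar ''m'') (Seq next_row_prog advance_prog))))"

text \<open>The digits of \<open>k\<close> are read from the lowest up, so intervals are peeled off
  the end of the first \<open>k\<close> points. At a set digit, \<open>cut\<close> is first moved to
  the start of the interval, whose point is the translation vector.\<close>

definition initial_prod_prog :: com where
  "initial_prod_prog =
     Seq (FAssign ''x'' (FRead ''nodes'' (IVar ''j'')))
     (Seq (FAssign ''d'' FOne)
     (Seq (IAssign ''row'' (IConst 0))
     (Seq (IAssign ''cut'' (IVar ''k''))
     (Seq (IAssign ''p'' (IConst 1))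
       (for_less ''b'' (IOp IAdd (IVar ''m'') (IConst 1))
         (Seq (Cond (IEq (IOp IBit (IVar ''k'') (IVar ''b'')) (IConst 1))
             (Seq (IAssign ''cut'' (IOp ISub (IVar ''cut'') (IVar ''p'')))
               (FAssign ''d'' (FOp FMul (FVar ''d'') (FRead ''table'' (IOp IAdd (IVar ''row'')
                 (Index (FOp FSub (FVar ''x'') (Point (IVar ''cut'')))))))))
             Skip)
           advance_prog))))))"

text \<open>The table is read in row 0, hence as \<open>nz\<close>; in particular the divisor is
  never zero.\<close>

definition weight_prog :: com where
  "weight_prog = for_less ''i'' (IVar ''t'')
     (FAssign ''d'' (FOp FDiv
       (FOp FMul (FVar ''d'') (FRead ''table'' (Index (FOp FSub (FVar ''x'')
         (FRead ''nodes'' (IOp IAdd (IOp ISub (IVar ''k'') (IVar ''t'')) (IVar ''i'')))))))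
       (FRead ''table'' (Index (FOp FSub (FVar ''x'') (FRead ''missing'' (IVar ''i'')))))))"

definition weights_prog :: com where
  "weights_prog = for_less ''j'' (IVar ''k'')
     (Seq initial_prod_prog (Seq weight_prog
       (FWrite ''weighted'' (IVar ''j'')
         (FOp FDiv (FRead ''known values'' (Index (FVar ''x''))) (FVar ''d'')))))"

definition interpolate_prog :: com where
  "interpolate_prog = for_less ''j'' (IVar ''k'')
     (Seq (FAssign ''d'' (FOp FMul (FVar ''d'')
         (FRead ''table'' (Index (FOp FSub (FVar ''x'') (FRead ''nodes'' (IVar ''j'')))))))
       (FAssign ''v'' (FOp FAdd (FVar ''v'') (FOp FDiv (FRead ''weighted'' (IVar ''j''))
         (FRead ''table'' (Index (FOp FSub (FRead ''nodes'' (IVar ''j'')) (FVar ''x''))))))))"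

definition recover_prog :: com where
  "recover_prog = for_less ''i'' (IVar ''t'')
     (Seq (FAssign ''x'' (FRead ''missing'' (IVar ''i'')))
     (Seq (FAssign ''d'' FOne)
     (Seq (FAssign ''v'' FZero)
     (Seq interpolate_prog
       (FWrite ''symbols'' (Index (FVar ''x''))
         (FOp FSub FZero (FOp FMul (FVar ''d'') (FVar ''v''))))))))"

definition decoder :: com where
  "decoder = Seq size_prog (Seq scan_prog (Seq split_prog (Seq table_prog
     (Seq weights_prog recover_prog))))"

section \<open>Correctness and running time of the program\<close>

context erasure_decoding
begin

text \<open>The interval peeled off has length \<open>2 ^ b\<close> and starts at a multiple of
  \<open>2 ^ (b + 1)\<close>, so \<open>dprod_block_shift\<close> identifies its product with a
  table entry.\<close>

lemma dprod_cut_Suc: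
  assumes "x \<in> carrier F" "bit k b"
  shows "cut b = cut (Suc b) + 2 ^ b"
    and "dprod x (block (cut (Suc b)) k) = dprod x (block (cut b) k) \<otimes> subspace_prod b (x \<ominus> pnt (cut (Suc b)))"
proof -
  show cut: "cut b = cut (Suc b) + 2 ^ b" using cut_Suc[of b] assms(2) by simp
  have le: "cut b \<le> k" "cut b \<le> q" using cut_le[of b] k(2) by auto
  have "2 ^ b dvd cut (Suc b)" using cut_dvd[of "Suc b"] by (rule power_le_dvd) simp
  then have "dprod x (block (cut (Suc b)) (cut b)) = subspace_prod b (x \<ominus> pnt (cut (Suc b)))"
    using dprod_block_shift[of b "cut (Suc b)" x] assms(1) le by (simp add: subspace_prod_def cut)
  moreover have "dprod x (block (cut (Suc b)) k) =
      dprod x (block (cut (Suc b)) (cut b)) \<otimes> dprod x (block (cut b) k)"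
    using dprod_block_split[of "cut (Suc b)" "cut b" k x] assms(1) le k(2) cut by simp
  ultimately show "dprod x (block (cut (Suc b)) k) =
      dprod x (block (cut b) k) \<otimes> subspace_prod b (x \<ominus> pnt (cut (Suc b)))"
    using assms(1) by (simp add: m_comm)
qed

text \<open>Opaque names for \<open>2 ^ m\<close> and for a bound on all integers, so that the simplifier sees
  linear side conditions.\<close>

definition N :: nat where "N = 2 ^ m"

definition W :: int where "W = 2 * int N * int N"

abbreviation runs :: "com \<Rightarrow> state \<Rightarrow> (nat \<Rightarrow> state \<Rightarrow> bool) \<Rightarrow> bool" where
  "runs \<equiv> wp m F (4 * m)"

lemma N_ge: "2 \<le> N"
  using power_increasing[OF m, of "2::nat"] by (simp add: N_def)

text \<open>As \<open>N ^ 2\<close> is at least 4, \<open>2 N ^ 2\<close> is below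
  \<open>N ^ 4 = 2 ^ (4 m)\<close>; hence words of \<open>4 m\<close> bits.\<close>

lemma W_less: "W < 2 ^ (4 * m)"
proof -
  have "4 \<le> N * N" using mult_le_mono[OF N_ge N_ge] by simp
  then have "2 * (N * N) < N * N * (N * N)" using N_ge by (intro mult_strict_right_mono) auto
  moreover have "N * N * (N * N) = 2 ^ (4 * m)"
    by (simp add: N_def flip: power_add)
  ultimately have "2 * (N * N) < 2 ^ (4 * m)" by simp
  then have "int (2 * (N * N)) < int (2 ^ (4 * m))" by (simp only: of_nat_less_iff)
  then show ?thesis by (simp add: W_def)
qed

lemma word_eq [simp]: "0 \<le> z \<Longrightarrow> z \<le> W \<Longrightarrow> word (4 * m) z = Some z"
  using W_less by (simp add: word_def)

lemma address_of_nat [simp]: "address (int i) = Some i"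
  by (simp add: address_def)

lemma address_row [simp]:
  "address (int b * int n + int i) = Some (b * n + i)"
  "address (int b * int n + int n + int i) = Some (Suc b * n + i)"
  by (simp_all add: address_def nat_add_distrib nat_mult_distrib)

lemma k_le: "k \<le> N" using k(2) by (simp add: N_def)

lemma m_less: "m < N"
  using less_exp[of m] by (simp add: N_def)

text \<open>Since \<open>m < N\<close>, the \<open>m + 1\<close> rows of the table fit into
  \<open>N ^ 2\<close> addresses. This also covers \<open>row\<close> after its last
  advance.\<close>

lemma W_row: "b \<le> m \<Longrightarrow> int b * int N + int N \<le> W"
proof -
  assume "b \<le> m"
  then have "Suc b * N \<le> N * N" using m_less by (intro mult_right_mono) auto
  then have "int (Suc b * N) \<le> int (N * N)" by (simp only: of_nat_le_iff)
  then have "int b * int N + int N \<le> int N * int N" by (simp add: algebra_simps)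
  moreover have "W = int N * int N + int N * int N" "0 \<le> int N * int N" by (simp_all add: W_def)
  ultimately show ?thesis by linarith
qed

lemma W_ge: "4 \<le> W" "2 * int N \<le> W" "int m + 1 \<le> W" "int k \<le> W"
proof -
  have "2 * int N \<le> W" using N_ge mult_left_mono[of 1 "int N" "2 * int N"] by (simp add: W_def)
  then show "4 \<le> W" "2 * int N \<le> W" "int m + 1 \<le> W" "int k \<le> W"
    using N_ge k_le m_less by auto
qed

lemma W_simps [simp]: "0 \<le> W" "1 \<le> W" "int N \<le> W" "int k \<le> W" "1 + int m \<le> W" "int m + 1 \<le> W"
  using W_ge by auto

lemma loop_bound: "int n \<le> W \<Longrightarrow> int n < 2 ^ (4 * m)" "0 < 4 * m"
  using W_less m by linarith+

lemma Point_eq [simp]: "i < N \<Longrightarrow> vec_of_int m (int i) = Some (pnt i)"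
  by (simp add: N_def)

lemma idx_less_N [simp]: "x \<in> carrier F \<Longrightarrow> idx x < N"
  by (simp add: N_def)

lemma idx_pt_N [simp]: "i < N \<Longrightarrow> idx (pnt i) = i"
  by (simp add: N_def)

lemma word_idx [simp]: "x \<in> carrier F \<Longrightarrow> word (4 * m) (int (idx x)) = Some (int (idx x))"
  using W_ge(2) by (intro word_eq) (auto dest!: idx_less_N)

lemma idx_eq_iff: "x \<in> carrier F \<Longrightarrow> i < N \<Longrightarrow> idx x = i \<longleftrightarrow> x = pnt i"
  by (metis idx_pt_N pt_idx)

section \<open>Reading the input and splitting the points\<close>

definition dims :: "state \<Rightarrow> bool" where
  "dims s \<longleftrightarrow> ivar s ''m'' = int m \<and> ivar s ''k'' = int k \<and> ivar s ''q'' = int N"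

definition inputs :: "state \<Rightarrow> bool" where
  "inputs s \<longleftrightarrow> ivar s ''m'' = int m \<and> ivar s ''k'' = int k \<and> ivar s ''n'' = int (length xs) \<and>
     ivar s ''s'' = 0 \<and> ivar s ''t'' = 0 \<and> (\<forall>j. iarr s ''known'' j = 0) \<and>
     (\<forall>j<length xs. farr s ''points'' j = xs ! j \<and> farr s ''values'' j = eval P (xs ! j))"

lemma inputs_input_state: "inputs (input_state m k F xs (map (eval P) xs))"
  by (simp add: input_state_def inputs_def)

lemma size_correct:
  assumes "inputs s"
  shows "runs size_prog s (\<lambda>T s'. T \<le> 20 * (m + 1) \<and> inputs s' \<and> ivar s' ''q'' = int N)"
proof -
  have pow: "2 ^ i + 2 ^ i \<le> W" if "i < m" for i
  proof -
    have "(2 :: int) ^ Suc i \<le> 2 ^ m" using that by (intro power_increasing) auto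
    moreover have "2 * (2 :: int) ^ m \<le> W" using W_ge(2) by (simp add: N_def)
    moreover have "(0 :: int) \<le> 2 ^ m" by simp
    ultimately show ?thesis unfolding power_Suc by linarith
  qed
  show ?thesis
    unfolding size_prog_def
    apply simp
    apply (rule wp_for_less[where I = "\<lambda>i s. inputs s \<and> ivar s ''q'' = 2 ^ i" and N = m and B = 4])
    subgoal using assms by (simp add: inputs_def)
    subgoal by (simp add: inputs_def)
    subgoal for i s using pow[of i] by (simp add: inputs_def)
    subgoal by (rule loop_bound) (use W_ge(3) in linarith)
    subgoal by (rule loop_bound)
    subgoal by (simp add: N_def)
    done
qed

lemma length_xs: "length xs \<le> N"
  using card_mono[OF finite_pts xs(2)] distinct_card[OF xs(1)]
  by (simp add: carrier_F card_vectors N_def)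

definition scanned :: "nat \<Rightarrow> state \<Rightarrow> bool" where
  "scanned i s \<longleftrightarrow> dims s \<and> ivar s ''s'' = 0 \<and> ivar s ''t'' = 0 \<and>
     (\<forall>v\<in>carrier F. iarr s ''known'' (idx v) = of_bool (v \<in> set (take i xs)) \<and>
       (v \<in> set (take i xs) \<longrightarrow> farr s ''known values'' (idx v) = eval P v))"

lemma idx_inject: "x \<in> carrier F \<Longrightarrow> y \<in> carrier F \<Longrightarrow> idx x = idx y \<longleftrightarrow> x = y"
  by (metis pt_idx)

lemma scan_correct:
  assumes "inputs s" "ivar s ''q'' = int N"
  shows "runs scan_prog s (\<lambda>T s'. T \<le> 30 * (N + 1) \<and> scanned (length xs) s')"
proof -
  have le: "int (length xs) \<le> W" using length_xs W_ge by simp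
  let ?I = "\<lambda>i s. scanned i s \<and> ivar s ''n'' = int (length xs) \<and>
    (\<forall>j<length xs. farr s ''points'' j = xs ! j \<and> farr s ''values'' j = eval P (xs ! j))"
  show ?thesis
    unfolding scan_prog_def
    apply (rule wp_for_less[where I = ?I and N = "length xs" and B = 11])
    subgoal using assms by (simp add: inputs_def scanned_def dims_def)
    subgoal by simp
    subgoal for i s
    proof -
      assume i: "i < length xs" and I: "?I i s" and iv: "ivar s ''i'' = int i"
      have c: "xs ! i \<in> carrier F" using xs(2) i nth_mem[OF i] by auto
      show ?thesis
        using i I iv c by (simp add: scanned_def dims_def take_Suc_conv_app_nth idx_inject)
    qed
    subgoal by (rule loop_bound) (use le in auto)
    subgoal by (rule loop_bound)
    subgoal for T s'
      using length_xs order_trans[of T "(length xs + 1) * 21" "30 * (N + 1)"] by simp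
    done
qed

definition lists_array :: "(nat \<Rightarrow> vec) \<Rightarrow> vec list \<Rightarrow> bool" where
  "lists_array a vs \<longleftrightarrow> (\<forall>i<length vs. a i = vs ! i)"

lemma lists_array_append: "lists_array a vs \<Longrightarrow> lists_array (a(length vs := v)) (vs @ [v])"
  by (auto simp: lists_array_def nth_append less_Suc_eq)

definition split :: "nat \<Rightarrow> state \<Rightarrow> bool" where
  "split i s \<longleftrightarrow> dims s \<and> ivar s ''t'' = int (length (missing_upto i)) \<and>
     lists_array (farr s ''nodes'') (known_upto i) \<and>
     lists_array (farr s ''missing'') (missing_upto i) \<and>
     (\<forall>v\<in>set xs. farr s ''known values'' (idx v) = eval P v) \<and>
     (\<forall>j<i. pnt j \<in> set xs \<longrightarrow> farr s ''symbols'' j = eval P (pnt j))"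

lemma split_correct:
  assumes "scanned (length xs) s"
  shows "runs split_prog s (\<lambda>T s'. T \<le> 40 * (N + 1) \<and> split N s')"
proof -
  let ?I = "\<lambda>i s. split i s \<and> ivar s ''s'' = int (length (known_upto i)) \<and>
    (\<forall>v\<in>carrier F. iarr s ''known'' (idx v) = of_bool (v \<in> set xs))"
  show ?thesis
    unfolding split_prog_def
    apply (rule wp_for_less[where I = ?I and N = N and B = 30])
    subgoal using assms xs(2)
      by (auto simp: split_def scanned_def dims_def lists_array_def known_upto_0 missing_upto_0)
    subgoal by (simp add: split_def dims_def)
    subgoal for i s
    proof -
      assume i: "i < N" and I: "?I i s" and iv: "ivar s ''i'' = int i"
      have kn: "iarr s ''known'' i = of_bool (pnt i \<in> set xs)"
        using I i pt_closed[of i] by (metis idx_pt_N)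
      have kv: "farr s ''known values'' i = eval P (pnt i)" if "pnt i \<in> set xs"
        using I i that unfolding split_def by (metis idx_pt_N)
      have W: "int (length (known_upto i)) + 1 \<le> W" "int (length (missing_upto i)) + 1 \<le> W"
        using length_known_upto[of i] length_missing_upto[of i] k_le W_ge N_ge by linarith+
      show ?thesis
        using i I iv kn kv W
        by (auto simp: split_def dims_def known_upto_Suc missing_upto_Suc lists_array_append less_Suc_eq)
    qed
    subgoal by (rule loop_bound) simp
    subgoal by (rule loop_bound)
    subgoal by simp
    done
qed

section \<open>The table of subspace products\<close>

definition tabled :: "nat \<Rightarrow> state \<Rightarrow> bool" where
  "tabled b s \<longleftrightarrow> split N s \<and>
     (\<forall>c\<le>b. \<forall>v\<in>carrier F. farr s ''table'' (c * N + idx v) = subspace_prod c v)"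

text \<open>Quotient and remainder by \<open>N\<close> recover row and column, so a write to one row
  leaves the others intact.\<close>

lemma table_index_eq:
  assumes "u < N" "v < N"
  shows "b * N + u = c * N + v \<longleftrightarrow> b = c \<and> u = v"
proof
  assume eq: "b * N + u = c * N + v"
  have "(b * N + u) div N = b" "(c * N + v) div N = c" using assms by auto
  then show "b = c \<and> u = v" using eq by auto
qed simp

lemma first_row_correct:
  assumes "split N s"
  shows "runs first_row_prog s (\<lambda>T s'. T \<le> 30 * (N + 1) \<and> tabled 0 s')"
proof -
  let ?I = "\<lambda>i s. split N s \<and>
    (\<forall>v\<in>carrier F. idx v < i \<longrightarrow> farr s ''table'' (idx v) = subspace_prod 0 v)"
  show ?thesis
    unfolding first_row_prog_def
    apply (rule wp_for_less[where I = ?I and N = N and B = 15])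
    subgoal using assms by (simp add: split_def dims_def)
    subgoal by (simp add: split_def dims_def)
    subgoal for i s
      by (auto simp: split_def dims_def less_Suc_eq idx_eq_iff subspace_prod_0 nz_def)
    subgoal by (rule loop_bound) simp
    subgoal by (rule loop_bound)
    subgoal by (simp add: tabled_def)
    done
qed

lemma next_row_correct:
  assumes "tabled b s" "b < m" "ivar s ''row'' = int (b * N)" "ivar s ''p'' = 2 ^ b"
    "ivar s ''b'' = int b"
  shows "runs next_row_prog s (\<lambda>T s'. T \<le> 40 * (N + 1) \<and> tabled (Suc b) s' \<and>
    ivar s' ''row'' = int (b * N) \<and> ivar s' ''p'' = 2 ^ b \<and> ivar s' ''b'' = int b)"
proof -
  let ?I = "\<lambda>i s. tabled b s \<and> ivar s ''row'' = int (b * N) \<and> ivar s ''p'' = 2 ^ b \<and>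
    ivar s ''b'' = int b \<and>
    (\<forall>v\<in>carrier F. idx v < i \<longrightarrow> farr s ''table'' (Suc b * N + idx v) = subspace_prod (Suc b) v)"
  show ?thesis
    unfolding next_row_prog_def
    apply (rule wp_for_less[where I = ?I and N = N and B = 25])
    subgoal using assms by (simp add: tabled_def split_def dims_def)
    subgoal by (simp add: tabled_def split_def dims_def)
    subgoal for i s
    proof -
      assume i: "i < N" and I: "?I i s" and iv: "ivar s ''i'' = int i"
      let ?w = "pnt i \<ominus> pnt (2 ^ b)"
      \<comment> \<open>Here \<open>b < m\<close> makes \<open>2 ^ b\<close> the index of a
        point.\<close>
      have p: "vec_of_int m (2 ^ b) = Some (pnt (2 ^ b))"
        using assms(2) vec_of_int_of_nat[of "2 ^ b" m] by simp
      have row: "int b * int N + int N + int N \<le> W"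
        using W_row[of "Suc b"] assms(2) by (simp add: algebra_simps)
      have w: "?w \<in> carrier F" "int (idx ?w) < int N" by simp_all
      have word: "word (4 * m) (int b * int N + int N) = Some (int b * int N + int N)"
        "word (4 * m) (int b * int N + int N + int i) = Some (int b * int N + int N + int i)"
        "word (4 * m) (int b * int N + int i) = Some (int b * int N + int i)"
        "word (4 * m) (int b * int N + int (idx ?w)) = Some (int b * int N + int (idx ?w))"
        using row i w(2) zero_le_mult_iff[of "int b" "int N"] by (intro word_eq; linarith)+
      have t: "farr s ''table'' (b * N + i) = subspace_prod b (pnt i)"
        "farr s ''table'' (b * N + idx ?w) = subspace_prod b ?w"
        using I i w(1) pt_closed[of i] unfolding tabled_def by (metis idx_pt_N order_refl)+
      show ?thesis
        using i I iv p word t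
        apply (simp add: tabled_def split_def dims_def less_Suc_eq idx_eq_iff subspace_prod_Suc[OF assms(2)] table_index_eq del: mult_Suc)
        done
    qed
    subgoal by (rule loop_bound) simp
    subgoal by (rule loop_bound)
    subgoal by (auto simp: tabled_def le_Suc_eq)
    done
qed

text \<open>Giving the exact final state lets the lemma serve loops with different invariants. At
  \<open>b = m\<close> the register \<open>p\<close> reaches \<open>2 ^ (m + 1)\<close>, still
  within \<open>2 N\<close>.\<close>

lemma advance_correct:
  assumes "ivar s ''q'' = int N" "ivar s ''row'' = int (b * N)" "ivar s ''p'' = 2 ^ b" "b \<le> m"
  shows "runs advance_prog s (\<lambda>T s'. T \<le> 8 \<and>
    s' = s\<lparr>ivar := (ivar s)(''row'' := int (Suc b * N), ''p'' := 2 ^ Suc b)\<rparr>)"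
proof -
  have "(2 :: int) ^ b \<le> 2 ^ m" using assms(4) by (intro power_increasing) auto
  moreover have "2 * (2 :: int) ^ m \<le> W" using W_ge(2) by (simp add: N_def)
  ultimately have p: "(2 :: int) ^ b + 2 ^ b \<le> W" by linarith
  have "int b * int N + int N \<le> W" using W_row assms(4) .
  then show ?thesis
    using assms p unfolding advance_prog_def by (simp add: add.commute)
qed

lemma table_correct:
  assumes "split N s"
  shows "runs table_prog s (\<lambda>T s'. T \<le> 40 * (N + 1) + 100 * (N + 1) * (m + 1) \<and> tabled m s')"
proof -
  let ?I = "\<lambda>b s. tabled b s \<and> ivar s ''row'' = int (b * N) \<and> ivar s ''p'' = 2 ^ b"
  have loop: "runs (for_less ''b'' (IVar ''m'') (Seq next_row_prog advance_prog)) s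
      (\<lambda>T s'. T \<le> (m + 1) * (40 * (N + 1) + 18) \<and> tabled m s')" if "?I 0 s" for s
    apply (rule wp_for_less[where I = ?I and N = m and B = "40 * (N + 1) + 8"])
    subgoal using that by (simp add: tabled_def split_def dims_def)
    subgoal by (simp add: tabled_def split_def dims_def)
    subgoal for b s
      unfolding wp_Seq
      apply (rule wp_mono[OF next_row_correct[of b]])
           apply simp_all[5]
      apply (rule wp_mono[OF advance_correct[of _ b]])
      apply (auto simp: tabled_def split_def dims_def)
      done
    subgoal by (rule loop_bound) (use W_ge(3) in linarith)
    subgoal by (rule loop_bound)
    subgoal by simp
    done
  show ?thesis
    unfolding table_prog_def wp_Seq
    apply (rule wp_mono[OF first_row_correct[OF assms]])
    apply simp
    apply (rule wp_mono[OF loop])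
    apply (auto simp: tabled_def split_def dims_def algebra_simps)
    done
qed

section \<open>Computation of the weights\<close>

definition weighted_upto :: "nat \<Rightarrow> state \<Rightarrow> bool" where
  "weighted_upto j s \<longleftrightarrow> tabled m s \<and> (\<forall>i<j. farr s ''weighted'' i = weighted i)"

lemma initial_prod_correct:
  assumes "weighted_upto j s" "ivar s ''j'' = int j" "j < k"
  shows "runs initial_prod_prog s (\<lambda>T s'. T \<le> 60 * (m + 2) \<and> weighted_upto j s' \<and>
    ivar s' ''j'' = int j \<and> fvar s' ''x'' = nodes ! j \<and> fvar s' ''d'' = dprod (nodes ! j) (block 0 k))"
proof -
  let ?x = "nodes ! j"
  have x: "?x \<in> carrier F" using assms(3) by simp
  let ?J = "\<lambda>s. weighted_upto j s \<and> ivar s ''j'' = int j \<and> fvar s ''x'' = ?x"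
  \<comment> \<open>The product grows from the end of the first \<open>k\<close> points: the block
    is empty for \<open>b = 0\<close>, as \<open>cut 0 = k\<close>, and complete for
    \<open>b = m + 1\<close>, as \<open>cut (m + 1) = 0\<close>.\<close>
  let ?I = "\<lambda>b s. ?J s \<and> fvar s ''d'' = dprod ?x (block (cut b) k) \<and>
    ivar s ''cut'' = int (cut b) \<and> ivar s ''row'' = int (b * N) \<and> ivar s ''p'' = 2 ^ b"
  have loop: "runs (for_less ''b'' (IOp IAdd (IVar ''m'') (IConst 1)) (Seq
        (Cond (IEq (IOp IBit (IVar ''k'') (IVar ''b'')) (IConst 1))
             (Seq (IAssign ''cut'' (IOp ISub (IVar ''cut'') (IVar ''p'')))
               (FAssign ''d'' (FOp FMul (FVar ''d'') (FRead ''table'' (IOp IAdd (IVar ''row'')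
                 (Index (FOp FSub (FVar ''x'') (Point (IVar ''cut'')))))))))
             Skip)
           advance_prog)) s
      (\<lambda>T s'. T \<le> 50 * (m + 2) \<and> ?I (m + 1) s')" if "?I 0 s" for s
    apply (rule wp_for_less[where I = ?I and N = "m + 1" and B = 38])
    subgoal using that by (simp add: weighted_upto_def tabled_def split_def dims_def)
    subgoal by (simp add: weighted_upto_def tabled_def split_def dims_def)
    subgoal for b s
    proof -
      assume b: "b < m + 1" and I: "?I b s" and iv: "ivar s ''b'' = int b"
      have adv: "runs advance_prog s' (\<lambda>T s''. T \<le> 8 \<and>
          s'' = s'\<lparr>ivar := (ivar s')(''row'' := int (Suc b * N), ''p'' := 2 ^ Suc b)\<rparr>)"
        if "ivar s' ''q'' = int N" "ivar s' ''row'' = int (b * N)" "ivar s' ''p'' = 2 ^ b" for s'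
        using advance_correct[of s' b] b that by simp
      have kb: "bit (int k) b = bit k b" by (simp add: bit_of_nat_iff_bit)
      have q: "ivar s ''q'' = int N" "ivar s ''k'' = int k"
        using I by (simp_all add: weighted_upto_def tabled_def split_def dims_def)
      show ?thesis
      proof (cases "bit k b")
        case False
        then show ?thesis
          using I iv q kb cut_Suc[of b]
          apply simp
          apply (rule wp_mono[OF adv])
          apply (auto simp: weighted_upto_def tabled_def split_def dims_def)
          done
      next
        case True
        let ?c = "cut (Suc b)"
        let ?w = "?x \<ominus> pnt ?c"
        have cut: "int (cut b) = int ?c + 2 ^ b" using dprod_cut_Suc(1)[OF x True] by simp
        \<comment> \<open>Strict although \<open>k\<close> may equal \<open>N\<close>, because the
          interval starting at this index is nonempty; so \<open>Point\<close> is defined.\<close>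
        have c: "?c < N" using dprod_cut_Suc(1)[OF x True] cut_le[of b] k_le
          by (metis add_leD1 add_less_cancel_left le_trans less_add_same_cancel1 linorder_not_less pos2 zero_less_power)
        have w: "?w \<in> carrier F" "int (idx ?w) < int N" using x by simp_all
        have t: "farr s ''table'' (b * N + idx ?w) = subspace_prod b ?w"
          using I b w(1) by (simp add: weighted_upto_def tabled_def)
        have cc: "word (4 * m) (int ?c) = Some (int ?c)" using c W_ge by (intro word_eq) linarith+
        have word: "word (4 * m) (int b * int N + int (idx ?w)) = Some (int b * int N + int (idx ?w))"
          using W_row[of b] b w(2) zero_le_mult_iff[of "int b" "int N"]
          by (intro word_eq; linarith)
        show ?thesis
          using I iv q kb True x c cc t word dprod_cut_Suc(2)[OF x True]
          apply (simp add: cut)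
          apply (rule wp_mono[OF adv])
          apply (auto simp: weighted_upto_def tabled_def split_def dims_def)
          done
      qed
    qed
    subgoal by (rule loop_bound) (use W_ge(3) in linarith)
    subgoal by (rule loop_bound)
    subgoal by simp
    done
  have "lists_array (farr s ''nodes'') nodes"
    using assms(1) by (simp add: weighted_upto_def tabled_def split_def N_def)
  then have nd: "farr s ''nodes'' j = ?x" using assms(3) by (simp add: lists_array_def length_nodes)
  show ?thesis
    unfolding initial_prod_prog_def
    using assms nd
    apply simp
    apply (rule wp_mono[OF loop])
    apply (auto simp: weighted_upto_def tabled_def split_def dims_def cut_m cut_0)
    done
qed

text \<open>What the later phases read off the machine state; row 0 of the table appears as
  \<open>nz\<close>.\<close>

lemma weighted_uptoD:
  assumes "weighted_upto j s"
  shows "ivar s ''k'' = int k" "ivar s ''t'' = int num_missing" "ivar s ''m'' = int m"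
    "i < k \<Longrightarrow> farr s ''nodes'' i = nodes ! i"
    "l < num_missing \<Longrightarrow> farr s ''missing'' l = missing ! l"
    "v \<in> carrier F \<Longrightarrow> farr s ''table'' (idx v) = nz v"
    "v \<in> set xs \<Longrightarrow> farr s ''known values'' (idx v) = eval P v"
    "i < j \<Longrightarrow> farr s ''weighted'' i = weighted i"
proof -
  have t: "tabled m s" and s: "split N s" using assms by (auto simp: weighted_upto_def tabled_def)
  then have "lists_array (farr s ''nodes'') nodes" "lists_array (farr s ''missing'') missing"
    by (simp_all add: split_def N_def)
  then show "i < k \<Longrightarrow> farr s ''nodes'' i = nodes ! i"
    "l < num_missing \<Longrightarrow> farr s ''missing'' l = missing ! l"
    by (simp_all add: lists_array_def length_nodes)
  show "farr s ''table'' (idx v) = nz v" if "v \<in> carrier F"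
    using t that subspace_prod_0[OF that] unfolding tabled_def by fastforce
  show "ivar s ''t'' = int num_missing" using s by (simp add: split_def N_def)
qed (use assms in \<open>auto simp: weighted_upto_def tabled_def split_def dims_def\<close>)

lemma num_missing_le: "num_missing \<le> k"
  by (rule length_missing_upto)

lemma weight_correct:
  assumes "weighted_upto j s" "ivar s ''j'' = int j" "j < k" "fvar s ''x'' = nodes ! j"
    "fvar s ''d'' = dprod (nodes ! j) (block 0 k)"
  shows "runs weight_prog s (\<lambda>T s'. T \<le> 40 * (num_missing + 1) \<and> weighted_upto j s' \<and>
    ivar s' ''j'' = int j \<and> fvar s' ''x'' = nodes ! j \<and> fvar s' ''d'' = dprod (nodes ! j) (set nodes))"
proof -
  let ?x = "nodes ! j"
  have x: "?x \<in> carrier F" using assms(3) by simp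
  let ?I = "\<lambda>l s. weighted_upto j s \<and> ivar s ''j'' = int j \<and> fvar s ''x'' = ?x \<and>
    fvar s ''d'' = partial_weight ?x l"
  show ?thesis
    unfolding weight_prog_def
    apply (rule wp_for_less[where I = ?I and N = num_missing and B = 20])
    subgoal using assms x
      by (simp add: partial_weight_0 weighted_upto_def tabled_def split_def dims_def)
    subgoal for l s using weighted_uptoD(2)[of j s] by simp
    subgoal for l s
    proof -
      assume l: "l < num_missing" and I: "?I l s" and iv: "ivar s ''i'' = int l"
      let ?n = "k - num_missing + l"
      have n: "?n < k" using l num_missing_le by simp
      have nd: "nodes ! ?n = extra ! l" by (rule extra_nth[OF l])
      \<comment> \<open>\<open>num_missing_le\<close> keeps the intermediate difference
        nonnegative.\<close>
      have word: "word (4 * m) (int k - int num_missing) = Some (int k - int num_missing)"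
        "word (4 * m) (int k - int num_missing + int l) = Some (int k - int num_missing + int l)"
        using W_ge(4) n num_missing_le by (intro word_eq; linarith)+
      have "int k - int num_missing + int l = int ?n" using num_missing_le by linarith
      then have addr: "address (int k - int num_missing + int l) = Some ?n" by (simp only: address_of_nat)
      have c: "extra ! l \<in> carrier F" "missing ! l \<in> carrier F" using l by simp_all
      have wu: "weighted_upto j s" using I by simp
      have rd: "farr s ''nodes'' ?n = extra ! l" "farr s ''missing'' l = missing ! l"
        "farr s ''table'' (idx (?x \<ominus> extra ! l)) = nz (?x \<ominus> extra ! l)"
        "farr s ''table'' (idx (?x \<ominus> missing ! l)) = nz (?x \<ominus> missing ! l)"
        using weighted_uptoD(4)[OF wu n] weighted_uptoD(5)[OF wu l] weighted_uptoD(6)[OF wu] x c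
        by (simp_all add: nd)
      have xd: "fvar s ''x'' = ?x" "fvar s ''d'' = partial_weight ?x l" "ivar s ''j'' = int j"
        using I by simp_all
      note kt = weighted_uptoD(1,2)[OF wu]
      have wu': "weighted_upto j (s\<lparr>fvar := f, ivar := (ivar s)(''i'' := i)\<rparr>)" for f i
        using wu by (simp add: weighted_upto_def tabled_def split_def dims_def)
      show ?thesis
        using x c word addr rd xd kt iv wu' by (simp add: partial_weight_Suc[OF x l])
    qed
    subgoal by (rule loop_bound) (use num_missing_le W_ge(4) in linarith)
    subgoal by (rule loop_bound)
    subgoal by (simp add: partial_weight_full x)
    done
qed

text \<open>Each of the \<open>k\<close> nodes costs O(m) for the digits of \<open>k\<close> and
  O(t) for the exchanged points.\<close>

lemma weights_correct:
  assumes "tabled m s"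
  shows "runs weights_prog s (\<lambda>T s'. T \<le> (k + 1) * (60 * (m + 2) + 40 * (num_missing + 1) + 20) \<and>
    weighted_upto k s')"
  unfolding weights_prog_def
  apply (rule wp_for_less[where I = weighted_upto and N = k
        and B = "60 * (m + 2) + 40 * (num_missing + 1) + 10"])
  subgoal using assms by (simp add: weighted_upto_def tabled_def split_def dims_def)
  subgoal for j s using weighted_uptoD(1)[of j s] by simp
  subgoal for j s
    unfolding wp_Seq
    apply (rule wp_mono[OF initial_prod_correct[of j]])
       apply simp_all[3]
    apply (elim conjE)
    apply (rule wp_mono[OF weight_correct[of j]])
         apply simp_all[5]
    subgoal for T1 s1 T2 s2
    proof -
      assume j: "j < k" and T: "T1 \<le> 60 * (m + 2)"
        and *: "T2 \<le> 40 * (num_missing + 1) \<and> weighted_upto j s2 \<and> ivar s2 ''j'' = int j \<and>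
          fvar s2 ''x'' = nodes ! j \<and> fvar s2 ''d'' = dprod (nodes ! j) (set nodes)"
      have x: "nodes ! j \<in> carrier F" "nodes ! j \<in> set xs"
        using j nodes_known length_nodes nth_mem[of j nodes] by auto
      show ?thesis
        using j T * x set_nodes weighted_uptoD(7)[of j s2 "nodes ! j"]
        by (auto simp: weighted_def[symmetric] weighted_upto_def tabled_def split_def dims_def less_Suc_eq)
    qed
    done
  subgoal by (rule loop_bound) simp
  subgoal by (rule loop_bound)
  subgoal by simp
  done

section \<open>Recovery of the missing symbols\<close>

definition recovered :: "nat \<Rightarrow> state \<Rightarrow> bool" where
  "recovered l s \<longleftrightarrow> weighted_upto k s \<and>
     (\<forall>i<l. farr s ''symbols'' (idx (missing ! i)) = eval P (missing ! i))"

lemma interpolate_correct: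
  assumes "recovered l s" "ivar s ''i'' = int l" "l < num_missing" "fvar s ''x'' = missing ! l"
    "fvar s ''d'' = \<one>" "fvar s ''v'' = \<zero>"
  shows "runs interpolate_prog s (\<lambda>T s'. T \<le> 40 * (k + 1) \<and> recovered l s' \<and>
    ivar s' ''i'' = int l \<and> fvar s' ''x'' = missing ! l \<and>
    fvar s' ''d'' = dprod (missing ! l) (set nodes) \<and> fvar s' ''v'' = partial_sum (missing ! l) k)"
proof -
  let ?x = "missing ! l"
  have x: "?x \<in> carrier F" using assms(3) by simp
  \<comment> \<open>The product over the nodes and the interpolation sum are accumulated in one
    pass, which makes the cost O(k) for each missing symbol.\<close>
  let ?I = "\<lambda>j s. recovered l s \<and> ivar s ''i'' = int l \<and> fvar s ''x'' = ?x \<and>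
    fvar s ''d'' = dprod ?x (set (take j nodes)) \<and> fvar s ''v'' = partial_sum ?x j"
  show ?thesis
    unfolding interpolate_prog_def
    apply (rule wp_for_less[where I = ?I and N = k and B = 25])
    subgoal using assms by (simp add: recovered_def weighted_upto_def tabled_def split_def dims_def)
    subgoal for j s using weighted_uptoD(1)[of k s] by (simp add: recovered_def)
    subgoal for j s
    proof -
      assume j: "j < k" and I: "?I j s" and iv: "ivar s ''j'' = int j"
      have wu: "weighted_upto k s" using I by (simp add: recovered_def)
      have c: "dprod ?x (set (take j nodes)) \<in> carrier F" "nodes ! j \<in> carrier F"
        using x take_carrier[OF set_nodes] j by simp_all
      show ?thesis
        using I iv j x c weighted_uptoD(4,6,8)[OF wu]
        by (simp add: partial_sum_Suc dprod_take_Suc[OF distinct_nodes set_nodes] length_nodes m_comm)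
          (simp add: recovered_def weighted_upto_def tabled_def split_def dims_def)
    qed
    subgoal by (rule loop_bound) simp
    subgoal by (rule loop_bound)
    subgoal by (simp add: length_nodes)
    done
qed

lemma recover_correct:
  assumes "weighted_upto k s"
  shows "runs recover_prog s (\<lambda>T s'. T \<le> (num_missing + 1) * (40 * (k + 1) + 30) \<and>
    recovered num_missing s')"
  unfolding recover_prog_def
  apply (rule wp_for_less[where I = recovered and N = num_missing and B = "40 * (k + 1) + 20"])
  subgoal using assms by (simp add: recovered_def weighted_upto_def tabled_def split_def dims_def)
  subgoal for l s using weighted_uptoD(2)[of k s] by (simp add: recovered_def)
  subgoal for l s
    using weighted_uptoD(5)[of k s l] apply (simp add: recovered_def)
    apply (rule wp_mono[OF interpolate_correct[of l]])
    subgoal by (simp add: recovered_def weighted_upto_def tabled_def split_def dims_def)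
    subgoal by simp
    subgoal by simp
    subgoal by simp
    subgoal by simp
    subgoal by simp
    subgoal for T s'
    proof -
      assume l: "l < num_missing"
        and *: "T \<le> 40 * (k + 1) \<and> recovered l s' \<and> ivar s' ''i'' = int l \<and>
          fvar s' ''x'' = missing ! l \<and> fvar s' ''d'' = dprod (missing ! l) (set nodes) \<and>
          fvar s' ''v'' = partial_sum (missing ! l) k"
      have x: "missing ! l \<in> carrier F" "missing ! l \<notin> set xs"
        using l nth_mem[OF l] by (auto simp: set_missing)
      have c: "dprod (missing ! l) (set nodes) \<in> carrier F" "partial_sum (missing ! l) k \<in> carrier F"
        using x set_nodes by simp_all
      \<comment> \<open>Writing a missing symbol leaves the entries copied from known points
        unchanged.\<close>
      have ne: "j \<noteq> idx (missing ! l)" if "j < N" "pnt j \<in> set xs" for j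
        using that x by auto
      let ?a = "(farr s' ''symbols'')(idx (missing ! l) :=
        \<zero> \<ominus> dprod (missing ! l) (set nodes) \<otimes> partial_sum (missing ! l) k)"
      have old: "farr s' ''symbols'' (idx (missing ! i)) = eval P (missing ! i)" if "i < l" for i
        using * that by (simp add: recovered_def)
      have new: "?a (idx (missing ! i)) = eval P (missing ! i)" if "i < Suc l" for i
      proof (cases "missing ! i = missing ! l")
        case True
        then show ?thesis using eval_missing[OF l] by simp
      next
        case False
        then have "i < l" using that by (auto simp: less_Suc_eq)
        then show ?thesis using False old l x(1) by (simp add: idx_inject)
      qed
      have "weighted_upto k (s'\<lparr>farr := (farr s')(''symbols'' := ?a), ivar := (ivar s')(''i'' := i)\<rparr>)" for i
        using * ne by (simp add: recovered_def weighted_upto_def tabled_def split_def dims_def)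
      then show ?thesis
        using * x c new by (simp add: recovered_def del: fun_upd_apply[of "farr s' ''symbols''"])
    qed
    done
  subgoal by (rule loop_bound) (use num_missing_le W_ge(4) in linarith)
  subgoal by (rule loop_bound)
  subgoal by simp
  done

text \<open>Only the product of \<open>num_missing\<close> and \<open>k\<close> has to be kept:
  since \<open>m \<ge> 1\<close>, every other term of the phase bounds, in particular
  \<open>k * m\<close>, is at most a constant times \<open>N * m\<close>.\<close>

lemma decoder_correct:
  "runs decoder (input_state m k F xs (map (eval P) xs)) (\<lambda>T s.
     T \<le> 1500 * (N * m + num_missing * k) \<and> recovered num_missing s)"
  unfolding decoder_def wp_Seq
  apply (rule wp_mono[OF size_correct[OF inputs_input_state]], elim conjE)
  apply (rule wp_mono[OF scan_correct], assumption, assumption, elim conjE)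
  apply (rule wp_mono[OF split_correct], assumption, elim conjE)
  apply (rule wp_mono[OF table_correct], assumption, elim conjE)
  apply (rule wp_mono[OF weights_correct], assumption, elim conjE)
  apply (rule wp_mono[OF recover_correct], assumption, elim conjE)
  subgoal for T1 s1 T2 s2 T3 s3 T4 s4 T5 s5 T6 s6
  proof -
    assume T: "T1 \<le> 20 * (m + 1)" "T2 \<le> 30 * (N + 1)" "T3 \<le> 40 * (N + 1)"
      "T4 \<le> 40 * (N + 1) + 100 * (N + 1) * (m + 1)"
      "T5 \<le> (k + 1) * (60 * (m + 2) + 40 * (num_missing + 1) + 20)"
      "T6 \<le> (num_missing + 1) * (40 * (k + 1) + 30)"
      and r: "recovered num_missing s6"
    define t where "t = num_missing"
    define A B D where "A = N * m" and "B = t * k" and "D = k * m"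
    have "N \<le> A" "D \<le> A" "m \<le> N" "k \<le> N" "t \<le> N" "1 \<le> N"
      using m m_less k_le num_missing_le N_ge by (auto simp: t_def A_def D_def)
    moreover have "T1 + (T2 + (T3 + (T4 + (T5 + T6)))) \<le>
        20 * m + 210 * N + 100 * A + 100 * m + 60 * D + 60 * m + 80 * B + 220 * k + 120 * t + 600"
      using T unfolding t_def[symmetric] by (simp add: A_def B_def D_def algebra_simps)
    \<comment> \<open>Apart from that of \<open>B\<close>, the coefficients add up to 1490.\<close>
    ultimately have "T1 + (T2 + (T3 + (T4 + (T5 + T6)))) \<le> 1500 * (A + B)"
      by simp
    then show ?thesis using r by (simp add: t_def A_def B_def)
  qed
  done

text \<open>Each of the first \<open>k\<close> symbols was either copied from the input or belongs
  to a missing point.\<close>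

lemma recovered_symbols:
  assumes "recovered num_missing s"
  shows "read_symbols k s = systematic_symbols m k F P"
proof -
  have "farr s ''symbols'' i = eval P (pnt i)" if i: "i < k" for i
  proof (cases "pnt i \<in> set xs")
    case True
    have "split N s" using assms by (simp add: recovered_def weighted_upto_def tabled_def)
    then show ?thesis using True i k_le by (simp add: split_def)
  next
    case False
    then have "pnt i \<in> set missing" using i by (simp add: set_missing)
    then obtain l where "l < num_missing" "missing ! l = pnt i" by (auto simp: in_set_conv_nth)
    moreover have "i < N" using i k_le by simp
    ultimately show ?thesis using assms by (auto simp: recovered_def dest!: spec[of _ l])
  qed
  then show ?thesis
    using k by (simp add: read_symbols_def systematic_symbols_def codeword_def points_eq take_map)
qed

lemma card_missing: "card (set (take k (points m)) - set xs) = num_missing"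
  using distinct_card[OF distinct_missing] k by (simp add: set_missing points_eq take_map)

end

theorem mainTheorem4:
  shows "\<exists>(p :: com) (c :: nat) (C :: real).
    \<forall>(m :: nat) (q :: nat) (k :: nat) (F :: vec ring) (P :: vec list) (K :: vec set) (xs :: vec list) (t :: nat).
      m \<ge> 1 \<longrightarrow> q = 2 ^ m \<longrightarrow> 1 \<le> k \<longrightarrow> k \<le> q \<longrightarrow>
      binary_field m F \<longrightarrow>
      P \<in> carrier (univ_poly F (carrier F)) \<longrightarrow> degree P < k \<longrightarrow>
      K \<subseteq> carrier F \<longrightarrow> k \<le> card K \<longrightarrow>
      distinct xs \<longrightarrow> set xs = K \<longrightarrow>
      t = card (set (take k (points m)) - K) \<longrightarrow>
      (\<exists>T s. exec m F (c * m) p (input_state m k F xs (map (ring.eval F P) xs)) T s \<and>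
             read_symbols k s = systematic_symbols m k F P \<and>
             real T \<le> C * (real q * log 2 (real q) + real t * real k))"
proof (rule exI[of _ decoder], rule exI[of _ 4], rule exI[of _ 1500], intro allI impI)
  fix m q k F P K xs t
  assume m: "1 \<le> m" and q: "q = 2 ^ m" and k: "1 \<le> k" "k \<le> q" and F: "binary_field m F"
    and P: "P \<in> carrier (univ_poly F (carrier F))" "degree P < k"
    and K: "K \<subseteq> carrier F" "k \<le> card K" and known: "distinct xs" "set xs = K"
    and t: "t = card (set (take k (points m)) - K)"
  interpret field F using F by (simp add: binary_field_def)
  have "polynomial\<^bsub>F\<^esub> (carrier F) P" using P(1) univ_poly_carrier by blast
  then have "set P \<subseteq> carrier F" using polynomial_in_carrier[OF carrier_is_subring] by blast
  \<comment> \<open>\<open>degree P\<close> is \<open>length P - 1\<close> with truncated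
    subtraction, so \<open>degree P < k\<close> and \<open>k \<ge> 1\<close> give
    \<open>length P \<le> k\<close>, also for the zero polynomial.\<close>
  then interpret erasure_decoding F m k P xs
    using m q k F P(2) K known distinct_card[OF known(1)]
    by unfold_locales (auto simp: binary_field_def)
  obtain T s where run: "exec m F (4 * m) decoder (input_state m k F xs (map (eval P) xs)) T s"
    and T: "T \<le> 1500 * (N * m + num_missing * k)" and s: "recovered num_missing s"
    using decoder_correct unfolding wp_def by blast
  have "t = num_missing" using t known(2) card_missing by simp
  then have "real T \<le> real (1500 * (q * m + t * k))"
    using T q by (simp only: of_nat_le_iff N_def)
  \<comment> \<open>From \<open>q = 2 ^ m\<close>, the factor \<open>m\<close> is
    \<open>log 2 q\<close>.\<close>
  also have "\<dots> = 1500 * (real q * log 2 (real q) + real t * real k)"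
    using q by simp
  finally show "\<exists>T s. exec m F (4 * m) decoder (input_state m k F xs (map (ring.eval F P) xs)) T s \<and>
      read_symbols k s = systematic_symbols m k F P \<and>
      real T \<le> 1500 * (real q * log 2 (real q) + real t * real k)"
    using run recovered_symbols[OF s] by blast
qed

end
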